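(* Let $j\in\mathbb{Z}$, let $x>0$, and let $q,m$ be non-negative integers. If the function $f\in E$ admits the derivative $f^{(2q+2m)}(x)$, then the derivatives of $S_{n,j}f$ possess the asymptotic expansion $$\left(S_{n,j}f\right)^{(m)}(x)=\sum_{k=0}^{q}c_{k,j}^{(m)}(f,x)\,n^{-k}+o\left(n^{-q}\right)\qquad (n\rightarrow\infty),$$ where $$c_{k,j}(f,x)=\frac{1}{k!}\left(\mathcal{D}_j^{2k}f\right)(x)=\frac{1}{k!}x^{j}\left(x^{k-j}f^{(k)}(x)\right)^{(k)}$$ and $c_{k,j}^{(m)}(f,x)$ denotes the $m$-th derivative of $c_{k,j}(f,x)$ with respect to $x$. In a more explicit form, $$\left(S_{n,j}f\right)^{(m)}(x)=\sum_{k=0}^{q}\frac{1}{n^{k}}\sum_{i=0}^{k}\frac{1}{i!}\binom{k+m-j}{k-i}x^{i}f^{(k+m+i)}(x)+o\left(n^{-q}\right)\qquad (n\to\infty).$$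
   Context: For $A\ge 0$, $E_A$ denotes the space of locally integrable functions $f:[0,\infty)\to\mathbb{R}$ satisfying $|f(t)|\le Ke^{At}$ for all $t\ge 0$, for some constant $K>0$; and $E:=\bigcup_{A\ge 0}E_A$. Put $s_{n,k}(x)=\frac{(nx)^k}{k!}e^{-nx}$ for integers $k\ge 0$ and $s_{n,k}(x)=0$ for $k<0$. For $j\in\mathbb{Z}$, $f\in E_A$ and positive integers $n>A$, the operator $S_{n,j}$ is defined for $x\ge0$ by $$(S_{n,j}f)(x)=f(0)\sum_{k=0}^{j-1}s_{n,k}(x)+\sum_{k=j}^{\infty}s_{n,k}(x)\,n\int_0^\infty s_{n,k-j}(t)f(t)\,dt.$$ A sum is zero if its upper limit is smaller than its lower limit. The differential operator $\mathcal{D}_j^{2k}$ for $k\in\mathbb{N}=\{1,2,\dots\}$ is $\mathcal{D}_j^{2k}=e_jD^k(e_{k-j}D^k)$, where $D$ is ordinary differentiation and $e_\ell(t)=t^\ell$ (also for negative integers $\ell$, at $t>0$); $\mathcal{D}_j^{0}$ is the identity operator. Binomial coefficients are generalized: $\binom{a}{r}=a(a-1)\cdots(a-r+1)/r!$ for an integer $a$ (possibly negative) and an integer $r\ge 0$.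
   Formalization: For q = m = 0, where the existence of f^{(0)}(x) alone is no condition and the claim fails (e.g. f the indicator function of the point x), f is additionally assumed to be continuous at x. *)

theory Defs
  imports "HOL-Analysis.Analysis" "HOL-Library.Landau_Symbols"
begin

text \<open>Functions on the half-line are represented by total functions on the reals, whose values
  at negative arguments play no role.\<close>

definition exp_space :: "real \<Rightarrow> (real \<Rightarrow> real) set" where
  "exp_space A = {f. (\<forall>b\<ge>0. f absolutely_integrable_on {0..b}) \<and>
                     (\<exists>K>0. \<forall>t\<ge>0. \<bar>f t\<bar> \<le> K * exp (A * t))}"

definition exp_space_union :: "(real \<Rightarrow> real) set" where
  "exp_space_union = (\<Union>A\<in>{0..}. exp_space A)"

definition szasz_basis :: "nat \<Rightarrow> int \<Rightarrow> real \<Rightarrow> real" where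
  "szasz_basis n k x =
     (if k < 0 then 0 else (real n * x) ^ nat k / fact (nat k) * exp (- (real n * x)))"

text \<open>The series over the integers \<open>k \<ge> j\<close> is indexed by \<open>i = k - j\<close>. The definition is
  meaningful for \<open>f\<close> in \<open>exp_space A\<close> and \<open>n > A\<close>, where the integrals exist and the series
  converges; for the remaining \<open>n\<close> the values are arbitrary.\<close>

definition szasz_durrmeyer :: "nat \<Rightarrow> int \<Rightarrow> (real \<Rightarrow> real) \<Rightarrow> real \<Rightarrow> real" where
  "szasz_durrmeyer n j f x =
     f 0 * (\<Sum>k\<in>{0..j - 1}. szasz_basis n k x) +
     (\<Sum>i. szasz_basis n (j + int i) x *
           (real n * (LINT t:{0..}|lebesgue. szasz_basis n (int i) t * f t)))"

text \<open>Existence of the derivative of order \<open>r\<close> at the point \<open>x\<close>: the derivative of order \<open>r - 1\<close>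
  exists in a neighbourhood of \<open>x\<close> and is differentiable at \<open>x\<close>. The value of that derivative is
  then \<open>(deriv ^^ r) f x\<close>.\<close>

primrec admits_deriv :: "nat \<Rightarrow> (real \<Rightarrow> real) \<Rightarrow> real \<Rightarrow> bool" where
  "admits_deriv 0 f x \<longleftrightarrow> True"
| "admits_deriv (Suc r) f x \<longleftrightarrow>
     (\<forall>\<^sub>F y in nhds x. admits_deriv r f y) \<and> (deriv ^^ r) f field_differentiable (at x)"

text \<open>\<open>diff_op j k\<close> is the operator of order \<open>2 * k\<close>; only its values at positive arguments matter.\<close>

definition diff_op :: "int \<Rightarrow> nat \<Rightarrow> (real \<Rightarrow> real) \<Rightarrow> real \<Rightarrow> real" where
  "diff_op j k f =
     (if k = 0 then f
      else (\<lambda>x. x powi j * (deriv ^^ k) (\<lambda>t. t powi (int k - j) * (deriv ^^ k) f t) x))"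

definition expansion_coeff :: "nat \<Rightarrow> int \<Rightarrow> (real \<Rightarrow> real) \<Rightarrow> real \<Rightarrow> real" where
  "expansion_coeff k j f x = 1 / fact k * diff_op j k f x"

end

theory Submission
  imports Defs "HOL-Probability.Distributions"
begin

text \<open>
  The proof rests on one observation: all shifts \<open>j\<close> belong together. Written as a Poisson series with
  weights that include the terms with \<open>f 0\<close>, the operators satisfy
  \<open>(S\<^sub>j f)' = n (S\<^sub>j\<^sub>-\<^sub>1 f - S\<^sub>j f)\<close> on the whole line for large \<open>n\<close> (\<open>DERIV_szasz_durrmeyer\<close>). The explicit coefficients
  satisfy the corresponding recurrence in \<open>m\<close>, \<open>j\<close> and \<open>k\<close> by Pascal's rule
  (\<open>voronovskaja_coeff_deriv_order\<close>). Hence an expansion of the derivative of order \<open>m\<close> up to \<open>n\<^sup>-\<^sup>q\<^sup>-\<^sup>1\<close>, for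
  all \<open>j\<close>, gives one of the derivative of order \<open>m + 1\<close> up to \<open>n\<^sup>-\<^sup>q\<close>, and no derivative of the kernel needs
  to be estimated. This trade of one order of \<open>n\<close> for one derivative is also why smoothness of order
  \<open>2 q + 2 m\<close> appears (\<open>szasz_durrmeyer_deriv_expansion\<close>).

  What remains is the case \<open>m = 0\<close>. On polynomials, the inner integrals are gamma moments, the outer sums
  are factorial moments of the Poisson distribution, and two applications of Vandermonde's convolution
  give the coefficients, up to the exponentially small contribution of the finitely many indices below
  \<open>j\<close> (\<open>szasz_durrmeyer_poly_expansion\<close>). A general \<open>f\<close> differs from its Taylor polynomial of degree
  \<open>2 q\<close> by a function that is \<open>o((t - x) ^ (2 q))\<close> at \<open>x\<close> and grows at most exponentially; positivity of
  the operators, the decay of their central moments and their boundedness on exponentials show that its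
  image is \<open>o(n\<^sup>-\<^sup>q)\<close> (\<open>szasz_durrmeyer_localization\<close>).

  That the explicit coefficients are the derivatives of order \<open>m\<close> of \<open>x\<^sup>j (x\<^sup>k\<^sup>-\<^sup>j f\<^sup>(\<^sup>k\<^sup>))\<^sup>(\<^sup>k\<^sup>) / k!\<close> is a separate
  calculation with Leibniz' rule (\<open>expansion_coeff_higher_deriv\<close>).
\<close>

section \<open>Higher derivatives at a point\<close>

lemma admits_deriv_mono:
  assumes "admits_deriv s f x" "r \<le> s"
  shows "admits_deriv r f x"
  using assms(2,1)
proof (induction rule: dec_induct)
  case (step s)
  then show ?case by (auto dest: eventually_nhds_x_imp_x)
qed

lemma admits_deriv_funpow:
  assumes "admits_deriv (r + s) f x"
  shows "admits_deriv r ((deriv ^^ s) f) x"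
  using assms
proof (induction r arbitrary: x)
  case (Suc r)
  then show ?case
    by (auto simp: funpow_add elim!: eventually_mono)
qed simp

lemma admits_deriv_DERIV:
  assumes "admits_deriv r f x" "s < r"
  shows "((deriv ^^ s) f has_real_derivative (deriv ^^ Suc s) f x) (at x)"
proof -
  have "admits_deriv (Suc s) f x"
    by (rule admits_deriv_mono[OF assms(1)]) (use assms(2) in simp)
  then show ?thesis
    by (simp add: DERIV_deriv_iff_field_differentiable)
qed

text \<open>The step of an induction on the order: a closed formula for the derivative of order \<open>r\<close>, known at all
  points near \<open>x\<close>, is differentiated at \<open>x\<close> itself.\<close>
lemma admits_deriv_SucI:
  assumes ev: "\<forall>\<^sub>F y in nhds x. admits_deriv r F y \<and> (deriv ^^ r) F y = G y"
    and G: "(G has_real_derivative d) (at x)"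
  shows "admits_deriv (Suc r) F x" "(deriv ^^ Suc r) F x = d"
proof -
  have "((deriv ^^ r) F has_real_derivative d) (at x) \<longleftrightarrow> (G has_real_derivative d) (at x)"
    by (rule DERIV_cong_ev) (use ev in \<open>auto elim: eventually_mono\<close>)
  with G have D: "((deriv ^^ r) F has_real_derivative d) (at x)" by simp
  from ev have "\<forall>\<^sub>F y in nhds x. admits_deriv r F y" by (auto elim: eventually_mono)
  with D show "admits_deriv (Suc r) F x"
    by (auto simp: field_differentiable_def)
  from D show "(deriv ^^ Suc r) F x = d" by (simp add: DERIV_imp_deriv)
qed

lemma sum_mult_shift:
  fixes \<alpha> \<beta> u :: "nat \<Rightarrow> real"
  shows "(\<Sum>i\<le>l. \<alpha> i * u i) + (\<Sum>i\<le>l. \<beta> i * u (Suc i)) =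
    (\<Sum>i\<le>Suc l. ((if i \<le> l then \<alpha> i else 0) + (case i of 0 \<Rightarrow> 0 | Suc i' \<Rightarrow> \<beta> i')) * u i)"
proof -
  have "(\<Sum>i\<le>Suc l. (if i \<le> l then \<alpha> i else 0) * u i) = (\<Sum>i\<le>l. \<alpha> i * u i)"
    by simp
  moreover have "(\<Sum>i\<le>Suc l. (case i of 0 \<Rightarrow> 0 | Suc i' \<Rightarrow> \<beta> i') * u i) = (\<Sum>i\<le>l. \<beta> i * u (Suc i))"
    by (subst sum.atMost_Suc_shift) simp
  ultimately show ?thesis by (simp only: distrib_right sum.distrib)
qed

text \<open>Leibniz' rule for a product with an integer power. The product of \<open>l choose i\<close> and the
  falling factorial of \<open>a\<close> of length \<open>l - i\<close> is written as
  \<open>fact l / fact i * (a gchoose (l - i))\<close>, for which the step of the induction is the identity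
  \<open>(a - k) * (a gchoose k) = (k + 1) * (a gchoose (k + 1))\<close>.\<close>
lemma powi_mult_higher_deriv:
  fixes a :: int and x :: real
  assumes "x > 0" "admits_deriv l g x"
  shows "admits_deriv l (\<lambda>t. t powi a * g t) x \<and>
    (deriv ^^ l) (\<lambda>t. t powi a * g t) x =
      (\<Sum>i\<le>l. fact l / fact i * (real_of_int a gchoose (l - i)) *
        (x powi (a - int (l - i)) * (deriv ^^ i) g x))"
  using assms
proof (induction l arbitrary: x)
  case (Suc l)
  let ?b = "real_of_int a"
  let ?h = "\<lambda>t. t powi a * g t"
  define c where "c = (\<lambda>i. fact l / fact i * (?b gchoose (l - i)))"
  define G where "G = (\<lambda>y. \<Sum>i\<le>l. c i * (y powi (a - int (l - i)) * (deriv ^^ i) g y))"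
  have "\<forall>\<^sub>F y in nhds x. y > 0"
    by (rule order_tendstoD(1)[OF filterlim_ident Suc.prems(1)])
  moreover have "\<forall>\<^sub>F y in nhds x. admits_deriv l g y" using Suc.prems(2) by simp
  ultimately have ev: "\<forall>\<^sub>F y in nhds x. admits_deriv l ?h y \<and> (deriv ^^ l) ?h y = G y"
  proof eventually_elim
    case (elim y)
    from Suc.IH[OF this] show ?case unfolding G_def c_def .
  qed
  define u where "u = (\<lambda>i. x powi (a - int (Suc l - i)) * (deriv ^^ i) g x)"
  have D: "((deriv ^^ i) g has_real_derivative (deriv ^^ Suc i) g x) (at x)" if "i \<le> l" for i
    using admits_deriv_DERIV[OF Suc.prems(2), of i] that by simp
  have P: "((\<lambda>y. y powi b) has_real_derivative of_int b * x powi (b - 1)) (at x)" for b :: int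
    using DERIV_power_int[OF DERIV_ident, where n = b and x = x and s = UNIV] Suc.prems(1) by simp
  have "(G has_real_derivative (\<Sum>i\<le>l. c i * (x powi (a - int (l - i)) * (deriv ^^ Suc i) g x +
      (of_int (a - int (l - i)) * x powi (a - int (l - i) - 1)) * (deriv ^^ i) g x))) (at x)"
    unfolding G_def by (intro DERIV_sum DERIV_cmult DERIV_mult'[OF P D]) simp
  also have "(\<Sum>i\<le>l. c i * (x powi (a - int (l - i)) * (deriv ^^ Suc i) g x +
      (of_int (a - int (l - i)) * x powi (a - int (l - i) - 1)) * (deriv ^^ i) g x)) =
       (\<Sum>i\<le>l. (c i * (?b - real (l - i))) * u i) + (\<Sum>i\<le>l. c i * u (Suc i))"
    unfolding sum.distrib[symmetric]
    by (intro sum.cong refl) (auto simp: u_def algebra_simps of_nat_diff Suc_diff_le)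
  also have "\<dots> = (\<Sum>i\<le>Suc l. fact (Suc l) / fact i * (?b gchoose (Suc l - i)) * u i)"
    unfolding sum_mult_shift[of "\<lambda>i. c i * (?b - real (l - i))" u l c]
  proof (intro sum.cong refl arg_cong2[where f="(*)"])
    fix i assume i: "i \<in> {..Suc l}"
    have *: "(?b - real k) * (?b gchoose k) = real (Suc k) * (?b gchoose Suc k)" for k
      using gbinomial_mult_1[of ?b k] by (simp add: algebra_simps)
    show "(if i \<le> l then c i * (?b - real (l - i)) else 0) + (case i of 0 \<Rightarrow> 0 | Suc i' \<Rightarrow> c i') =
       fact (Suc l) / fact i * (?b gchoose (Suc l - i))"
    proof (cases i)
      case 0
      then show ?thesis using *[of l] by (simp add: c_def mult_ac)
    next
      case (Suc i')
      show ?thesis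
      proof (cases "i \<le> l")
        case True
        define k where "k = l - i"
        have k: "l - i = k" "l - i' = Suc k" "Suc l - i = Suc k" "l = k + Suc i'"
          using True Suc by (auto simp: k_def)
        have "c i * (?b - real (l - i)) = fact l / fact i * (real (Suc k) * (?b gchoose Suc k))"
          using *[of k] by (simp add: c_def k(1) mult_ac)
        moreover have "c i' = fact l / fact i * (real i * (?b gchoose Suc k))"
          by (simp add: c_def k(2) Suc del: of_nat_Suc)
        moreover have "fact (Suc l) / fact i * (?b gchoose (Suc l - i)) = 
            fact l / fact i * (real (Suc k + i) * (?b gchoose Suc k))"
          using Suc by (simp add: k(3)) (simp add: k(4) field_simps)
        ultimately show ?thesis using True Suc by (simp add: algebra_simps add_divide_distrib)
      next
        case False
        with i Suc have "i' = l" by simp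
        then show ?thesis using False Suc by (simp add: c_def)
      qed
    qed
  qed
  finally have "(G has_real_derivative (\<Sum>i\<le>Suc l. fact (Suc l) / fact i * (?b gchoose (Suc l - i)) * u i)) (at x)" .
  from admits_deriv_SucI[OF ev this] show ?case by (simp add: u_def)
qed simp

section \<open>Coefficients of the expansion\<close>

text \<open>The explicit coefficient of \<open>n\<^sup>-\<^sup>k\<close>, as a function of the sequence \<open>d\<close> of derivatives at \<open>x\<close>.
  Taking the jet \<open>d\<close> as the argument makes linearity visible and lets the same expression serve for
  functions and for polynomials.\<close>
definition voronovskaja_coeff :: "nat \<Rightarrow> int \<Rightarrow> nat \<Rightarrow> (nat \<Rightarrow> real) \<Rightarrow> real \<Rightarrow> real" where
  "voronovskaja_coeff m j k d x =
     (\<Sum>i=0..k. 1 / fact i * (real_of_int (int k + int m - j) gchoose (k - i)) * x ^ i * d (k + m + i))"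

text \<open>Pascal's rule. This recurrence for the coefficients mirrors the difference equation
  \<open>(S\<^sub>j f)' = n (S\<^sub>j\<^sub>-\<^sub>1 f - S\<^sub>j f)\<close> of the operators: multiplication by \<open>n\<close> shifts \<open>k\<close> by one.\<close>
lemma voronovskaja_coeff_deriv_order:
  "voronovskaja_coeff (Suc m) j k d x =
     voronovskaja_coeff m (j - 1) (Suc k) d x - voronovskaja_coeff m j (Suc k) d x"
proof -
  let ?b = "real_of_int (int k + int (Suc m) - j)"
  have "voronovskaja_coeff m (j - 1) (Suc k) d x - voronovskaja_coeff m j (Suc k) d x =
    (\<Sum>i=0..Suc k. 1 / fact i * ((?b + 1 gchoose (Suc k - i)) - (?b gchoose (Suc k - i))) *
       x ^ i * d (Suc k + m + i))"
    unfolding voronovskaja_coeff_def sum_subtractf[symmetric]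
    by (intro sum.cong refl) (simp add: algebra_simps)
  also have "\<dots> = (\<Sum>i=0..k. 1 / fact i * ((?b + 1 gchoose (Suc k - i)) - (?b gchoose (Suc k - i))) *
       x ^ i * d (Suc k + m + i))"
    by (simp add: sum.atLeast0_atMost_Suc)
  also have "\<dots> = (\<Sum>i=0..k. 1 / fact i * (?b gchoose (k - i)) * x ^ i * d (k + Suc m + i))"
  proof (intro sum.cong refl)
    fix i assume "i \<in> {0..k}"
    then have e: "Suc k - i = Suc (k - i)" by auto
    show "1 / fact i * ((?b + 1 gchoose (Suc k - i)) - (?b gchoose (Suc k - i))) * x ^ i * d (Suc k + m + i) =
        1 / fact i * (?b gchoose (k - i)) * x ^ i * d (k + Suc m + i)"
      unfolding e gbinomial_Suc_Suc by simp
  qed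
  finally show ?thesis by (simp add: voronovskaja_coeff_def)
qed

lemma voronovskaja_coeff_0: "voronovskaja_coeff m j 0 d x = d m"
  by (simp add: voronovskaja_coeff_def)

text \<open>Pascal's rule once more: differentiating \<open>x ^ i\<close> and differentiating the jet both contribute to the
  term with \<open>x ^ i\<close>, and the two binomial coefficients add up to the one for order \<open>m + 1\<close>.\<close>
lemma DERIV_voronovskaja_coeff:
  assumes d: "\<And>i. i \<le> k \<Longrightarrow> (d (k + m + i) has_real_derivative d (Suc (k + m + i)) x) (at x)"
  shows "((\<lambda>y. voronovskaja_coeff m j k (\<lambda>s. d s y) y) has_real_derivative
      voronovskaja_coeff (Suc m) j k (\<lambda>s. d s x) x) (at x)"
proof -
  let ?b = "real_of_int (int k + int m - j)"
  define c where "c = (\<lambda>i. 1 / fact i * (?b gchoose (k - i)))"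
  have "((\<lambda>y. voronovskaja_coeff m j k (\<lambda>s. d s y) y) has_real_derivative
      (\<Sum>i\<le>k. c i * (x ^ i * d (Suc (k + m + i)) x + real i * x ^ (i - 1) * d (k + m + i) x))) (at x)"
  proof -
    have "(\<lambda>y. voronovskaja_coeff m j k (\<lambda>s. d s y) y) = (\<lambda>y. \<Sum>i\<le>k. c i * (y ^ i * d (k + m + i) y))"
      by (simp add: voronovskaja_coeff_def atLeast0AtMost c_def mult_ac)
    then show ?thesis
      by (simp only:) (intro DERIV_sum DERIV_cmult DERIV_mult'[OF DERIV_pow d, THEN DERIV_cong], auto)
  qed
  also have "(\<Sum>i\<le>k. c i * (x ^ i * d (Suc (k + m + i)) x + real i * x ^ (i - 1) * d (k + m + i) x)) =
     (\<Sum>i\<le>k. c i * (x ^ i * d (Suc (k + m + i)) x)) + (\<Sum>i\<le>k. c i * (real i * x ^ (i - 1) * d (k + m + i) x))"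
    by (simp add: algebra_simps sum.distrib)
  also have "(\<Sum>i\<le>k. c i * (real i * x ^ (i - 1) * d (k + m + i) x)) =
     (\<Sum>i\<le>k. (if i < k then 1 / fact i * (?b gchoose (k - Suc i)) else 0) * (x ^ i * d (Suc (k + m + i)) x))"
  proof (cases k)
    case (Suc k')
    have "(\<Sum>i\<le>k. c i * (real i * x ^ (i - 1) * d (k + m + i) x)) =
      (\<Sum>i\<le>k'. c (Suc i) * (real (Suc i) * x ^ i * d (k + m + Suc i) x))"
      unfolding Suc by (subst sum.atMost_Suc_shift) simp
    also have "\<dots> = (\<Sum>i\<le>k'. 1 / fact i * (?b gchoose (k - Suc i)) * (x ^ i * d (Suc (k + m + i)) x))"
      by (intro sum.cong refl) (simp add: c_def field_simps del: of_nat_Suc)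
    also have "\<dots> = (\<Sum>i\<le>k. (if i < k then 1 / fact i * (?b gchoose (k - Suc i)) else 0) * (x ^ i * d (Suc (k + m + i)) x))"
      unfolding Suc by simp
    finally show ?thesis .
  qed simp
  also have "(\<Sum>i\<le>k. c i * (x ^ i * d (Suc (k + m + i)) x)) + \<dots> =
     voronovskaja_coeff (Suc m) j k (\<lambda>s. d s x) x"
    unfolding sum.distrib[symmetric] voronovskaja_coeff_def atLeast0AtMost
  proof (intro sum.cong refl)
    fix i assume i: "i \<in> {..k}"
    have b: "real_of_int (int k + int (Suc m) - j) = ?b + 1" by simp
    show "c i * (x ^ i * d (Suc (k + m + i)) x) +
         (if i < k then 1 / fact i * (?b gchoose (k - Suc i)) else 0) * (x ^ i * d (Suc (k + m + i)) x) =
         1 / fact i * (real_of_int (int k + int (Suc m) - j) gchoose (k - i)) * x ^ i * d (k + Suc m + i) x"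
    proof (cases "i < k")
      case True
      then obtain l where l: "k - i = Suc l" "k - Suc i = l" 
        by (metis Suc_diff_Suc)
      show ?thesis using True unfolding b c_def l gbinomial_Suc_Suc
        by (simp add: algebra_simps add_divide_distrib)
    next
      case False
      with i have "k = i" by simp
      then show ?thesis by (simp add: c_def)
    qed
  qed
  finally show ?thesis .
qed

text \<open>For \<open>k = 0\<close> the operator is the identity by definition; the powers \<open>x powi j\<close> and
  \<open>x powi (- j)\<close> cancel because \<open>x\<close> is positive.\<close>
lemma expansion_coeff_alt:
  assumes "x > 0"
  shows "expansion_coeff k j f x =
     1 / fact k * (x powi j * (deriv ^^ k) (\<lambda>t. t powi (int k - j) * (deriv ^^ k) f t) x)"
  using assms by (cases "k = 0") (auto simp: expansion_coeff_def diff_op_def power_int_minus)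

lemma expansion_coeff_higher_deriv:
  fixes x :: real
  assumes "x > 0" "admits_deriv (2 * k + m) f x"
  shows "admits_deriv m (expansion_coeff k j f) x \<and>
    (deriv ^^ m) (expansion_coeff k j f) x = voronovskaja_coeff m j k (\<lambda>s. (deriv ^^ s) f x) x"
  using assms
proof (induction m arbitrary: x)
  case 0
  have "(deriv ^^ k) (\<lambda>t. t powi (int k - j) * (deriv ^^ k) f t) x =
      (\<Sum>i\<le>k. fact k / fact i * (real_of_int (int k - j) gchoose (k - i)) *
        (x powi (int k - j - int (k - i)) * (deriv ^^ i) ((deriv ^^ k) f) x))"
    using powi_mult_higher_deriv[OF 0(1), of k "(deriv ^^ k) f" "int k - j"]
      admits_deriv_funpow[of k k f x] 0(2) by (simp add: mult_2)
  then have "expansion_coeff k j f x = (\<Sum>i\<le>k. 1 / fact k * (x powi j * (fact k / fact i * (real_of_int (int k - j) gchoose (k - i)) *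
        (x powi (int k - j - int (k - i)) * (deriv ^^ i) ((deriv ^^ k) f) x))))"
    unfolding expansion_coeff_alt[OF 0(1)] by (simp only: sum_distrib_left)
  also have "\<dots> = voronovskaja_coeff 0 j k (\<lambda>s. (deriv ^^ s) f x) x"
    unfolding voronovskaja_coeff_def atLeast0AtMost
  proof (intro sum.cong refl)
    fix i assume "i \<in> {..k}"
    then have e: "int k - j - int (k - i) = int i - j" by (simp add: of_nat_diff)
    have "x powi j * x powi (int i - j) = x ^ i"
      using 0(1) by (subst power_int_add[symmetric]) auto
    then have "1 / fact k * (x powi j * (fact k / fact i * (real_of_int (int k - j) gchoose (k - i)) *
        (x powi (int i - j) * (deriv ^^ i) ((deriv ^^ k) f) x))) =
       1 / fact i * (real_of_int (int k - j) gchoose (k - i)) * x ^ i * (deriv ^^ i) ((deriv ^^ k) f) x"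
      by (simp add: field_simps)
    then show "1 / fact k * (x powi j * (fact k / fact i * (real_of_int (int k - j) gchoose (k - i)) *
        (x powi (int k - j - int (k - i)) * (deriv ^^ i) ((deriv ^^ k) f) x))) =
       1 / fact i * (real_of_int (int k + int 0 - j) gchoose (k - i)) * x ^ i * (deriv ^^ (k + 0 + i)) f x"
      unfolding e by (simp add: funpow_add add.commute[of k i])
  qed
  finally show ?case by simp
next
  case (Suc m)
  have "\<forall>\<^sub>F y in nhds x. y > 0"
    by (rule order_tendstoD(1)[OF filterlim_ident Suc.prems(1)])
  moreover have "\<forall>\<^sub>F y in nhds x. admits_deriv (2 * k + m) f y" using Suc.prems(2) by simp
  ultimately have ev: "\<forall>\<^sub>F y in nhds x. admits_deriv m (expansion_coeff k j f) y \<and>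
      (deriv ^^ m) (expansion_coeff k j f) y = voronovskaja_coeff m j k (\<lambda>s. (deriv ^^ s) f y) y"
    by eventually_elim (rule Suc.IH)
  have "((\<lambda>y. voronovskaja_coeff m j k (\<lambda>s. (deriv ^^ s) f y) y) has_real_derivative
      voronovskaja_coeff (Suc m) j k (\<lambda>s. (deriv ^^ s) f x) x) (at x)"
    by (intro DERIV_voronovskaja_coeff admits_deriv_DERIV[OF Suc.prems(2)]) simp
  from admits_deriv_SucI[OF ev this] show ?case by simp
qed

section \<open>Taylor polynomials\<close>

text \<open>Taylor's theorem with Peano's remainder. The polynomial is only constrained by its derivatives at
  \<open>x\<close>, so that the induction can pass from \<open>f\<close> and \<open>p\<close> to their derivatives; the mean value inequality
  leads back.\<close>
lemma taylor_peano_poly: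
  fixes p :: "real poly"
  assumes "admits_deriv N f x" "N = 0 \<Longrightarrow> isCont f x"
    and "\<And>s. s \<le> N \<Longrightarrow> (deriv ^^ s) f x = poly ((pderiv ^^ s) p) x"
    and "e > 0"
  shows "\<forall>\<^sub>F t in nhds x. \<bar>f t - poly p t\<bar> \<le> e * \<bar>t - x\<bar> ^ N"
  using assms
proof (induction N arbitrary: f p)
  case 0
  have "isCont (\<lambda>t. \<bar>f t - poly p t\<bar>) x" using 0 by (intro continuous_intros) auto
  then have "((\<lambda>t. \<bar>f t - poly p t\<bar>) \<longlongrightarrow> 0) (nhds x)"
    using 0(3)[of 0] by (simp add: isCont_def tendsto_nhds_iff)
  from order_tendstoD(2)[OF this 0(4)] show ?case by (auto elim: eventually_mono)
next
  case (Suc N)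
  show ?case
  proof (cases "N = 0")
    case True
    have "(f has_real_derivative deriv f x) (at x)"
      using admits_deriv_DERIV[OF Suc.prems(1), of 0] by simp
    then have "((\<lambda>t. f t - poly p t) has_real_derivative 0) (at x)"
      using Suc.prems(3)[of 1] True by (auto intro!: derivative_eq_intros)
    then have "((\<lambda>t. ((f t - poly p t) - (f x - poly p x)) / (t - x)) \<longlongrightarrow> 0) (at x)"
      by (simp add: has_field_derivative_iff)
    then have "((\<lambda>t. \<bar>(f t - poly p t) / (t - x)\<bar>) \<longlongrightarrow> 0) (at x)"
      using Suc.prems(3)[of 0] tendsto_rabs_zero by force
    from order_tendstoD(2)[OF this Suc.prems(4)]
    show ?thesis
      unfolding eventually_at_filter
    proof eventually_elim
      case (elim t)
      then show ?case using Suc.prems(3)[of 0] by (cases "t = x") (auto simp: True abs_divide field_simps)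
    qed
  next
    case False
    have ad: "admits_deriv N (deriv f) x"
      using admits_deriv_funpow[of N 1 f x] Suc.prems(1) by simp
    have "(deriv ^^ s) (deriv f) x = poly ((pderiv ^^ s) (pderiv p)) x" if "s \<le> N" for s
      using Suc.prems(3)[of "Suc s"] that by (simp add: funpow_swap1)
    from Suc.IH[OF ad _ this Suc.prems(4)] False
    have "\<forall>\<^sub>F t in nhds x. \<bar>deriv f t - poly (pderiv p) t\<bar> \<le> e * \<bar>t - x\<bar> ^ N" by simp
    moreover have "\<forall>\<^sub>F t in nhds x. (f has_real_derivative deriv f t) (at t)"
    proof -
      have "\<forall>\<^sub>F t in nhds x. admits_deriv N f t" using Suc.prems(1) by simp
      then show ?thesis
        by eventually_elim (use admits_deriv_DERIV[of N f _ 0] False in auto)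
    qed
    ultimately have "\<forall>\<^sub>F t in nhds x. \<bar>deriv f t - poly (pderiv p) t\<bar> \<le> e * \<bar>t - x\<bar> ^ N \<and> (f has_real_derivative deriv f t) (at t)"
      by eventually_elim auto
    then obtain \<delta> where \<delta>: "\<delta> > 0" and 
      near: "\<And>t. dist t x < \<delta> \<Longrightarrow> \<bar>deriv f t - poly (pderiv p) t\<bar> \<le> e * \<bar>t - x\<bar> ^ N"
        "\<And>t. dist t x < \<delta> \<Longrightarrow> (f has_real_derivative deriv f t) (at t)"
      unfolding eventually_nhds_metric by blast
    have "\<bar>f t - poly p t\<bar> \<le> e * \<bar>t - x\<bar> ^ Suc N" if t: "dist t x < \<delta>" for t
    proof -
      have "\<bar>(f t - poly p t) - (f x - poly p x)\<bar> \<le> (e * \<bar>t - x\<bar> ^ N) * \<bar>t - x\<bar>"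
      proof (rule field_differentiable_bound[where S="closed_segment x t" and f="\<lambda>t. f t - poly p t"
            and f'="\<lambda>t. deriv f t - poly (pderiv p) t", unfolded real_norm_def])
        fix z assume z: "z \<in> closed_segment x t"
        have zx: "\<bar>z - x\<bar> \<le> \<bar>t - x\<bar>" using z by (auto simp: closed_segment_eq_real_ivl split: if_splits)
        with t have zd: "dist z x < \<delta>" by (simp add: dist_real_def)
        show "((\<lambda>t. f t - poly p t) has_real_derivative deriv f z - poly (pderiv p) z) (at z within closed_segment x t)"
          by (rule has_field_derivative_at_within, rule DERIV_diff[OF near(2)[OF zd] poly_DERIV])
        have "\<bar>deriv f z - poly (pderiv p) z\<bar> \<le> e * \<bar>z - x\<bar> ^ N" by (rule near(1)[OF zd])
        also have "\<dots> \<le> e * \<bar>t - x\<bar> ^ N"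
          using zx Suc.prems(4) by (intro mult_left_mono power_mono) auto
        finally show "\<bar>deriv f z - poly (pderiv p) z\<bar> \<le> e * \<bar>t - x\<bar> ^ N" .
      qed auto
      then show ?thesis using Suc.prems(3)[of 0] by (simp add: mult_ac)
    qed
    then show ?thesis unfolding eventually_nhds_metric using \<delta> by blast
  qed
qed

lemma poly_higher_pderiv_linear_power:
  fixes a x :: real
  shows "poly ((pderiv ^^ s) ([:- a, 1:] ^ r)) x =
    (if s \<le> r then fact r / fact (r - s) * (x - a) ^ (r - s) else 0)"
proof (induction r arbitrary: s)
  case 0
  then show ?case by (cases s) (simp_all add: funpow_swap1 pderiv_1)
next
  case (Suc r)
  show ?case
  proof (cases s)
    case (Suc s')
    have "pderiv ([:- a, 1:] ^ Suc r) = smult (real (Suc r)) ([:- a, 1:] ^ r)"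
      by (simp add: pderiv_power_Suc pderiv_pCons del: power_Suc)
    then show ?thesis using Suc.IH[of s']
      by (simp add: Suc funpow_swap1 higher_pderiv_smult del: power_Suc of_nat_Suc)
  qed (simp add: algebra_simps del: fact_Suc)
qed

lemma poly_with_prescribed_derivs:
  fixes d :: "nat \<Rightarrow> real"
  shows "\<exists>p. \<forall>s\<le>N. poly ((pderiv ^^ s) p) x = d s"
proof -
  define p where "p = (\<Sum>r\<le>N. smult (d r / fact r) ([:- x, 1:] ^ r))"
  have "poly ((pderiv ^^ s) p) x = d s" if "s \<le> N" for s
  proof -
    have "poly ((pderiv ^^ s) p) x = (\<Sum>r\<le>N. if s = r then d r else 0)"
      unfolding p_def higher_pderiv_sum higher_pderiv_smult poly_sum poly_smult poly_higher_pderiv_linear_power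
      by (intro sum.cong refl) auto
    then show ?thesis using that by simp
  qed
  then show ?thesis by blast
qed

section \<open>Functions of exponential growth\<close>

lemma exp_spaceD:
  assumes "f \<in> exp_space A"
  obtains K where "K > 0" "\<And>t. t \<ge> 0 \<Longrightarrow> \<bar>f t\<bar> \<le> K * exp (A * t)"
  using assms unfolding exp_space_def by auto

lemma exp_space_mono:
  assumes "f \<in> exp_space A" "A \<le> B"
  shows "f \<in> exp_space B"
proof -
  obtain K where K: "K > 0" "\<And>t. t \<ge> 0 \<Longrightarrow> \<bar>f t\<bar> \<le> K * exp (A * t)"
    using exp_spaceD[OF assms(1)] by blast
  have "\<bar>f t\<bar> \<le> K * exp (B * t)" if "t \<ge> 0" for t
  proof -
    have "K * exp (A * t) \<le> K * exp (B * t)"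
      using K(1) assms(2) that by (simp add: mult_right_mono)
    then show ?thesis using K(2)[OF that] by linarith
  qed
  then show ?thesis using assms(1) K(1) unfolding exp_space_def by blast
qed

lemma exp_space_add:
  assumes "f \<in> exp_space A" "g \<in> exp_space A"
  shows "(\<lambda>t. f t + g t) \<in> exp_space A"
proof -
  obtain K where K: "K > 0" "\<And>t. t \<ge> 0 \<Longrightarrow> \<bar>f t\<bar> \<le> K * exp (A * t)"
    using exp_spaceD[OF assms(1)] by blast
  obtain L where L: "L > 0" "\<And>t. t \<ge> 0 \<Longrightarrow> \<bar>g t\<bar> \<le> L * exp (A * t)"
    using exp_spaceD[OF assms(2)] by blast
  have "\<bar>f t + g t\<bar> \<le> (K + L) * exp (A * t)" if "t \<ge> 0" for t
    using K(2)[OF that] L(2)[OF that] by (simp add: distrib_right)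
  moreover have "K + L > 0" using K L by simp
  ultimately show ?thesis using assms unfolding exp_space_def by (auto intro: set_integral_add)
qed

lemma exp_space_cmult:
  assumes "f \<in> exp_space A"
  shows "(\<lambda>t. c * f t) \<in> exp_space A"
proof -
  obtain K where K: "K > 0" "\<And>t. t \<ge> 0 \<Longrightarrow> \<bar>f t\<bar> \<le> K * exp (A * t)"
    using exp_spaceD[OF assms(1)] by blast
  have "\<bar>c * f t\<bar> \<le> ((\<bar>c\<bar> + 1) * K) * exp (A * t)" if "t \<ge> 0" for t
    unfolding abs_mult mult.assoc using K(2)[OF that] by (intro mult_mono) auto
  moreover have "(\<bar>c\<bar> + 1) * K > 0" using K by (simp add: add_nonneg_pos)
  moreover have "(\<lambda>t. c * f t) absolutely_integrable_on {0..b}" if "b \<ge> 0" for b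
    using assms that unfolding exp_space_def by (simp add: set_integrable_mult_right)
  ultimately show ?thesis unfolding exp_space_def by blast
qed

lemma continuous_imp_exp_space:
  assumes "continuous_on UNIV f" "K > 0" "\<And>t. t \<ge> 0 \<Longrightarrow> \<bar>f t\<bar> \<le> K * exp (A * t)"
  shows "f \<in> exp_space A"
  using assms absolutely_integrable_continuous[of 0 _ f]
  unfolding exp_space_def by (auto intro: continuous_on_subset)

text \<open>The bound comes from a single term of the series of \<open>exp \<bar>t - a\<bar>\<close>.\<close>
lemma centered_power_exp_space:
  assumes "A \<ge> 1"
  shows "(\<lambda>t. (t - a) ^ r) \<in> exp_space A"
proof (rule exp_space_mono[OF continuous_imp_exp_space assms])
  show "\<bar>(t - a) ^ r\<bar> \<le> (fact r * exp \<bar>a\<bar>) * exp (1 * t)" if "t \<ge> 0" for t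
  proof -
    have "\<bar>t - a\<bar> ^ r / fact r \<le> exp \<bar>t - a\<bar>"
      using sum_le_suminf[OF summable_exp[of "\<bar>t - a\<bar>"], of "{r}"]
      by (simp add: exp_def field_simps)
    also have "\<dots> \<le> exp (\<bar>a\<bar> + t)" using that by auto
    finally show ?thesis by (simp add: power_abs field_simps exp_add)
  qed
qed (auto intro!: continuous_intros)

lemma exp_exp_space: "(\<lambda>t. exp (A * t)) \<in> exp_space A"
  by (rule continuous_imp_exp_space[of _ 1]) (auto intro!: continuous_intros)

lemma poly_exp_space:
  assumes "A \<ge> 1"
  shows "poly p \<in> exp_space A"
proof -
  have "(\<lambda>t. \<Sum>i\<le>N. coeff p i * t ^ i) \<in> exp_space A" for N
  proof (induction N)
    case 0
    show ?case using exp_space_cmult[OF centered_power_exp_space[OF assms, of 0 0], of "coeff p 0"] by simp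
  next
    case (Suc N)
    show ?case using exp_space_add[OF Suc exp_space_cmult[OF centered_power_exp_space[OF assms, of 0 "Suc N"], of "coeff p (Suc N)"]] by simp
  qed
  then show ?thesis by (simp add: poly_altdef[abs_def])
qed

text \<open>Local integrability gives measurability on every \<open>{0..N}\<close>, and the half-line is their limit.\<close>
lemma exp_space_borel_measurable:
  assumes "f \<in> exp_space A"
  shows "(\<lambda>t. indicator {0..} t * f t) \<in> borel_measurable lebesgue"
proof (rule borel_measurable_LIMSEQ_real)
  fix N :: nat
  have "set_integrable lebesgue {0..real N} f" using assms by (auto simp: exp_space_def)
  then show "(\<lambda>t. indicator {0..real N} t * f t) \<in> borel_measurable lebesgue"
    unfolding set_integrable_def by (simp add: borel_measurable_integrable)
next
  fix t :: real
  obtain N0 :: nat where "t \<le> real N0" using real_arch_simple by blast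
  then have "\<forall>\<^sub>F N in sequentially. indicator {0..real N} t * f t = indicator {0..} t * f t"
    by (intro eventually_sequentiallyI[of N0]) (auto simp: indicator_def)
  then show "(\<lambda>N. indicator {0..real N} t * f t) \<longlonglongrightarrow> indicator {0..} t * f t"
    by (rule tendsto_eventually)
qed

section \<open>Gamma means\<close>

text \<open>The moments of the Erlang distribution, moved from the Borel to the Lebesgue measure.\<close>
lemma erlang_moment_lebesgue:
  fixes l :: real
  assumes "l > 0"
  shows "set_integrable lebesgue {0..} (\<lambda>t. l ^ Suc i * t ^ i * exp (- l * t) / fact i * t ^ r)"
    and "(LINT t:{0..}|lebesgue. l ^ Suc i * t ^ i * exp (- l * t) / fact i * t ^ r) = fact (i + r) / (fact i * l ^ r)"
proof -
  have eq: "(\<lambda>t. indicator {0..} t *\<^sub>R (l ^ Suc i * t ^ i * exp (- l * t) / fact i * t ^ r)) = 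
     (\<lambda>t. erlang_density i l t * t ^ r)"
    by (auto simp: erlang_density_def indicator_def)
  have "has_bochner_integral lborel (\<lambda>t. erlang_density i l t * t ^ r) (fact (i + r) / (fact i * l ^ r))"
    using assms by (intro has_bochner_integral_nn_integral nn_integral_erlang_ith_moment AE_I2)
       (auto simp: erlang_density_def)
  then have "has_bochner_integral lebesgue (\<lambda>t. erlang_density i l t * t ^ r) (fact (i + r) / (fact i * l ^ r))"
    by (auto simp: has_bochner_integral_iff integrable_completion integral_completion)
  then show "set_integrable lebesgue {0..} (\<lambda>t. l ^ Suc i * t ^ i * exp (- l * t) / fact i * t ^ r)"
    and "(LINT t:{0..}|lebesgue. l ^ Suc i * t ^ i * exp (- l * t) / fact i * t ^ r) = fact (i + r) / (fact i * l ^ r)"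
    unfolding set_integrable_def set_lebesgue_integral_def eq by (auto simp: has_bochner_integral_iff)
qed

text \<open>The mean of \<open>f\<close> under the gamma distribution with shape \<open>i + 1\<close> and rate \<open>n\<close>.\<close>
definition gamma_mean :: "nat \<Rightarrow> nat \<Rightarrow> (real \<Rightarrow> real) \<Rightarrow> real" where
  "gamma_mean n i f = real n * (LINT t:{0..}|lebesgue. szasz_basis n (int i) t * f t)"

text \<open>Exponential tilting of the gamma density changes its rate from \<open>n\<close> to \<open>n - A\<close>. The factor \<open>t ^ 0\<close>
  puts the right-hand side into the form of the Erlang moments.\<close>
lemma szasz_basis_exp:
  assumes "real n > A"
  shows "real n * (szasz_basis n (int i) t * exp (A * t)) = (real n / (real n - A)) ^ Suc i *
     ((real n - A) ^ Suc i * t ^ i * exp (- (real n - A) * t) / fact i * t ^ 0)"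
proof -
  have "exp (- (real n - A) * t) = exp (- (real n * t)) * exp (A * t)"
    by (simp add: exp_add[symmetric] algebra_simps)
  then show ?thesis using assms
    by (simp add: szasz_basis_def power_mult_distrib power_divide)
qed

lemma gamma_mean_exp:
  assumes "real n > A" "A \<ge> 0"
  shows "set_integrable lebesgue {0..} (\<lambda>t. szasz_basis n (int i) t * exp (A * t))"
    and "gamma_mean n i (\<lambda>t. exp (A * t)) = (real n / (real n - A)) ^ Suc i"
proof -
  have l: "real n - A > 0" using assms by simp
  note e = erlang_moment_lebesgue[OF l, of i 0]
  have "set_integrable lebesgue {0..} (\<lambda>t. real n * (szasz_basis n (int i) t * exp (A * t)))"
    unfolding szasz_basis_exp[OF assms(1)] by (intro set_integrable_mult_right e(1))
  then show "set_integrable lebesgue {0..} (\<lambda>t. szasz_basis n (int i) t * exp (A * t))"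
    using set_integrable_mult_right_iff[of "real n"] assms
    by (cases "n = 0") (auto simp: szasz_basis_def)
  show "gamma_mean n i (\<lambda>t. exp (A * t)) = (real n / (real n - A)) ^ Suc i"
    unfolding gamma_mean_def set_integral_mult_right[symmetric] szasz_basis_exp[OF assms(1)]
    unfolding set_integral_mult_right e(2) by simp
qed

lemma szasz_basis_nonneg: "t \<ge> 0 \<Longrightarrow> szasz_basis n k t \<ge> 0"
  by (simp add: szasz_basis_def)

lemma szasz_basis_integrable:
  assumes "f \<in> exp_space A" "real n > A" "A \<ge> 0"
  shows "set_integrable lebesgue {0..} (\<lambda>t. szasz_basis n (int i) t * f t)"
proof -
  obtain K where K: "K > 0" "\<And>t. t \<ge> 0 \<Longrightarrow> \<bar>f t\<bar> \<le> K * exp (A * t)"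
    using exp_spaceD[OF assms(1)] by blast
  have "set_integrable lebesgue {0..} (\<lambda>t. K * (szasz_basis n (int i) t * exp (A * t)))"
    by (intro set_integrable_mult_right gamma_mean_exp assms)
  moreover have "set_borel_measurable lebesgue {0..} (\<lambda>t. szasz_basis n (int i) t * f t)"
  proof -
    have "(\<lambda>t. szasz_basis n (int i) t) \<in> borel_measurable lebesgue"
      unfolding szasz_basis_def by (intro measurable_completion) simp
    from borel_measurable_times[OF this exp_space_borel_measurable[OF assms(1)]]
    show ?thesis by (simp add: set_borel_measurable_def mult_ac)
  qed
  moreover have "AE t in lebesgue. t \<in> {0..} \<longrightarrow> norm (szasz_basis n (int i) t * f t)
      \<le> norm (K * (szasz_basis n (int i) t * exp (A * t)))"
  proof (intro AE_I2 impI)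
    fix t :: real assume "t \<in> {0..}"
    then have t: "t \<ge> 0" by simp
    have "szasz_basis n (int i) t * \<bar>f t\<bar> \<le> szasz_basis n (int i) t * (K * exp (A * t))"
      using K(2)[OF t] szasz_basis_nonneg[OF t] by (rule mult_left_mono)
    then show "norm (szasz_basis n (int i) t * f t) \<le> norm (K * (szasz_basis n (int i) t * exp (A * t)))"
      using szasz_basis_nonneg[OF t, of n "int i"] K(1) by (simp add: abs_mult mult_ac)
  qed
  ultimately show ?thesis by (rule set_integrable_bound)
qed

lemma gamma_mean_add:
  assumes "f \<in> exp_space A" "g \<in> exp_space A" "real n > A" "A \<ge> 0"
  shows "gamma_mean n i (\<lambda>t. f t + g t) = gamma_mean n i f + gamma_mean n i g"
  unfolding gamma_mean_def using assms
  by (simp add: distrib_left set_integral_add szasz_basis_integrable)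

lemma gamma_mean_cmult: "gamma_mean n i (\<lambda>t. c * f t) = c * gamma_mean n i f"
  unfolding gamma_mean_def by (simp add: mult.left_commute[of _ c])

lemma gamma_mean_abs_le:
  assumes "f \<in> exp_space A" "g \<in> exp_space A" "real n > A" "A \<ge> 0"
    and le: "\<And>t. t \<ge> 0 \<Longrightarrow> \<bar>f t\<bar> \<le> g t"
  shows "\<bar>gamma_mean n i f\<bar> \<le> gamma_mean n i g"
proof -
  let ?s = "szasz_basis n (int i)"
  note I = szasz_basis_integrable[OF assms(1,3,4), of i] szasz_basis_integrable[OF assms(2,3,4), of i]
  have p: "\<bar>?s t * f t\<bar> \<le> ?s t * g t" if "t \<ge> 0" for t
    unfolding abs_mult using szasz_basis_nonneg[OF that, of n "int i"] le[OF that]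
    by (simp add: mult_left_mono)
  have "(LINT t:{0..}|lebesgue. ?s t * f t) \<le> (LINT t:{0..}|lebesgue. ?s t * g t)"
    by (intro set_integral_mono I) (use p in force)
  moreover have "(LINT t:{0..}|lebesgue. - (?s t * f t)) \<le> (LINT t:{0..}|lebesgue. ?s t * g t)"
    by (intro set_integral_mono I) (use p I in \<open>force simp: set_integrable_def\<close>)+
  ultimately show ?thesis unfolding gamma_mean_def using I(1)
    by (simp add: abs_mult mult_left_mono set_integral_uminus)
qed

lemma gamma_mean_power:
  assumes "n > 0"
  shows "gamma_mean n i (\<lambda>t. t ^ r) = pochhammer (real i + 1) r / real n ^ r"
proof -
  have "gamma_mean n i (\<lambda>t. t ^ r) = (LINT t:{0..}|lebesgue. real n ^ Suc i * t ^ i * exp (- real n * t) / fact i * t ^ r)"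
    unfolding gamma_mean_def set_integral_mult_right[symmetric]
    by (simp add: szasz_basis_def power_mult_distrib mult_ac)
  also have "\<dots> = fact (i + r) / (fact i * real n ^ r)"
    using assms by (intro erlang_moment_lebesgue) simp
  also have "fact (i + r) = fact i * pochhammer (real i + 1) r"
    using pochhammer_product'[of 1 i r] by (simp add: pochhammer_fact add.commute)
  finally show ?thesis by simp
qed

section \<open>The operators as Poisson series\<close>

text \<open>The two sums in the definition of the operator become one Poisson series over \<open>k \<ge> 0\<close> with these
  weights: the terms with \<open>f 0\<close> fill the places \<open>k < j\<close>. A shift of \<open>k\<close> is then the same as a shift of
  \<open>j\<close>, boundary terms included.\<close>
definition durrmeyer_weight :: "nat \<Rightarrow> int \<Rightarrow> (real \<Rightarrow> real) \<Rightarrow> nat \<Rightarrow> real" where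
  "durrmeyer_weight n j f k = (if int k < j then f 0 else gamma_mean n (nat (int k - j)) f)"

lemma durrmeyer_weight_add:
  assumes "f \<in> exp_space A" "g \<in> exp_space A" "real n > A" "A \<ge> 0"
  shows "durrmeyer_weight n j (\<lambda>t. f t + g t) k = durrmeyer_weight n j f k + durrmeyer_weight n j g k"
  unfolding durrmeyer_weight_def using gamma_mean_add[OF assms] by simp

lemma durrmeyer_weight_cmult: "durrmeyer_weight n j (\<lambda>t. c * f t) k = c * durrmeyer_weight n j f k"
  by (simp add: durrmeyer_weight_def gamma_mean_cmult)

lemma durrmeyer_weight_abs_le:
  assumes "f \<in> exp_space A" "g \<in> exp_space A" "real n > A" "A \<ge> 0"
    and le: "\<And>t. t \<ge> 0 \<Longrightarrow> \<bar>f t\<bar> \<le> g t"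
  shows "\<bar>durrmeyer_weight n j f k\<bar> \<le> durrmeyer_weight n j g k"
  unfolding durrmeyer_weight_def using gamma_mean_abs_le[OF assms] le[of 0] by auto

lemma durrmeyer_weight_exp_le:
  assumes "real n > A" "A \<ge> 0"
  shows "durrmeyer_weight n j (\<lambda>t. exp (A * t)) k \<le> 
    (real n / (real n - A)) ^ (k + nat (1 - j))"
proof -
  have r: "1 \<le> real n / (real n - A)" using assms by simp
  show ?thesis
  proof (cases "int k < j")
    case True
    then show ?thesis using one_le_power[OF r] by (simp add: durrmeyer_weight_def)
  next
    case False
    then have "Suc (nat (int k - j)) \<le> k + nat (1 - j)" by linarith
    then show ?thesis using False power_increasing[OF _ r] 
      by (simp add: durrmeyer_weight_def gamma_mean_exp(2)[OF assms] del: power_Suc)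
  qed
qed

lemma exp_space_durrmeyer_weight_bound:
  assumes f: "f \<in> exp_space A" and n: "real n > A" "A \<ge> 0"
  obtains C where "C > 0" "\<And>k. \<bar>durrmeyer_weight n j f k\<bar> \<le> C * (real n / (real n - A)) ^ k"
proof -
  obtain K where K: "K > 0" "\<And>t. t \<ge> 0 \<Longrightarrow> \<bar>f t\<bar> \<le> K * exp (A * t)"
    using exp_spaceD[OF f] by blast
  let ?r = "real n / (real n - A)"
  have "\<bar>durrmeyer_weight n j f k\<bar> \<le> (K * ?r ^ nat (1 - j)) * ?r ^ k" for k
  proof -
    have "\<bar>durrmeyer_weight n j f k\<bar> \<le> durrmeyer_weight n j (\<lambda>t. K * exp (A * t)) k"
      by (intro durrmeyer_weight_abs_le[OF f exp_space_cmult[OF exp_exp_space] n] K)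
    also have "\<dots> \<le> K * ?r ^ (k + nat (1 - j))"
      unfolding durrmeyer_weight_cmult using K(1) durrmeyer_weight_exp_le[OF n] by simp
    finally show ?thesis by (simp add: power_add mult_ac)
  qed
  moreover have "K * ?r ^ nat (1 - j) > 0" using K n by simp
  ultimately show ?thesis using that by blast
qed

text \<open>The weights grow at most geometrically, so this power series converges everywhere.\<close>
lemma summable_durrmeyer_power_series:
  assumes f: "f \<in> exp_space A" and n: "real n > A" "A \<ge> 0"
  shows "summable (\<lambda>k. (real n ^ k / fact k * durrmeyer_weight n j f k) * y ^ k)"
proof -
  obtain C where C: "C > 0" "\<And>k. \<bar>durrmeyer_weight n j f k\<bar> \<le> C * (real n / (real n - A)) ^ k"
    using exp_space_durrmeyer_weight_bound[OF assms] by blast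
  let ?z = "real n * \<bar>y\<bar> * (real n / (real n - A))"
  have "summable (\<lambda>k. C * (inverse (fact k) * ?z ^ k))"
    by (intro summable_mult summable_exp)
  then show ?thesis
  proof (rule summable_comparison_test')
    fix k :: nat assume "k \<ge> 0"
    have "norm ((real n ^ k / fact k * durrmeyer_weight n j f k) * y ^ k) =
       (real n * \<bar>y\<bar>) ^ k / fact k * \<bar>durrmeyer_weight n j f k\<bar>"
      by (simp add: abs_mult power_abs power_mult_distrib)
    also have "\<dots> \<le> (real n * \<bar>y\<bar>) ^ k / fact k * (C * (real n / (real n - A)) ^ k)"
      by (intro mult_left_mono C) simp
    also have "\<dots> = C * (inverse (fact k) * ?z ^ k)"
      unfolding power_mult_distrib by (simp add: field_simps)
    finally show "norm ((real n ^ k / fact k * durrmeyer_weight n j f k) * y ^ k) \<le> C * (inverse (fact k) * ?z ^ k)" .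
  qed
qed

lemma szasz_basis_weight_eq:
  "szasz_basis n (int k) y * w = exp (- (real n * y)) * ((real n ^ k / fact k * w) * y ^ k)"
  by (simp add: szasz_basis_def power_mult_distrib)

lemma summable_durrmeyer:
  assumes "f \<in> exp_space A" "real n > A" "A \<ge> 0"
  shows "summable (\<lambda>k. szasz_basis n (int k) y * durrmeyer_weight n j f k)"
  unfolding szasz_basis_weight_eq by (intro summable_mult summable_durrmeyer_power_series[OF assms])

text \<open>For \<open>j < 0\<close> the first \<open>- j\<close> terms of the series in the definition vanish and are skipped; for
  \<open>j \<ge> 0\<close> the finite sum is the initial segment of the Poisson series.\<close>
lemma szasz_durrmeyer_eq:
  assumes "f \<in> exp_space A" "real n > A" "A \<ge> 0"
  shows "szasz_durrmeyer n j f y = (\<Sum>k. szasz_basis n (int k) y * durrmeyer_weight n j f k)"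
proof -
  define F where "F = (\<lambda>k. szasz_basis n (int k) y * durrmeyer_weight n j f k)"
  define G where "G = (\<lambda>i. szasz_basis n (j + int i) y * gamma_mean n i f)"
  have S: "szasz_durrmeyer n j f y = f 0 * (\<Sum>k\<in>{0..j - 1}. szasz_basis n k y) + suminf G"
    by (simp add: szasz_durrmeyer_def G_def gamma_mean_def)
  have sF: "summable F" unfolding F_def by (rule summable_durrmeyer[OF assms])
  show ?thesis
  proof (cases "j \<ge> 0")
    case True
    then obtain J where J: "j = int J" using nonneg_int_cases by blast
    have "{0..j - 1} = int ` {0..<J}" unfolding J image_int_atLeastLessThan by auto
    then have "f 0 * (\<Sum>k\<in>{0..j - 1}. szasz_basis n k y) = (\<Sum>k<J. F k)"
      by (simp add: sum.reindex sum_distrib_left F_def durrmeyer_weight_def J mult.commute atLeast0LessThan)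
    moreover have "G = (\<lambda>i. F (i + J))"
      by (simp add: G_def F_def durrmeyer_weight_def J add.commute)
    ultimately show ?thesis
      unfolding S F_def[symmetric] suminf_split_initial_segment[OF sF, of J] by simp
  next
    case False
    define J where "J = nat (- j)"
    have J: "j = - int J" using False by (simp add: J_def)
    have GF: "G (i + J) = F i" for i
      by (auto simp: G_def F_def durrmeyer_weight_def J nat_add_distrib)
    have "summable G" using sF unfolding summable_iff_shift[of G J, symmetric] GF .
    then have "suminf G = (\<Sum>i. G (i + J)) + (\<Sum>i<J. G i)" by (rule suminf_split_initial_segment)
    moreover have "(\<Sum>i<J. G i) = 0" by (intro sum.neutral) (auto simp: G_def szasz_basis_def J)
    ultimately show ?thesis using False unfolding S F_def[symmetric] GF by simp
  qed
qed

text \<open>The operator is \<open>exp (- n y)\<close> times a power series. Differentiating the latter shifts its weights by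
  one, which replaces \<open>j\<close> by \<open>j - 1\<close>; differentiating the exponential gives \<open>- n\<close> times the operator.\<close>
lemma DERIV_szasz_durrmeyer:
  assumes "f \<in> exp_space A" "real n > A" "A \<ge> 0"
  shows "(szasz_durrmeyer n j f has_real_derivative
    real n * (szasz_durrmeyer n (j - 1) f y - szasz_durrmeyer n j f y)) (at y)"
proof -
  define c where "c = (\<lambda>j k. real n ^ k / fact k * durrmeyer_weight n j f k)"
  define P where "P = (\<lambda>j y. \<Sum>k. c j k * y ^ k)"
  have sc: "summable (\<lambda>k. c j k * y ^ k)" for j y
    unfolding c_def by (rule summable_durrmeyer_power_series[OF assms])
  have S: "szasz_durrmeyer n j f y = exp (- (real n * y)) * P j y" for j y
    unfolding szasz_durrmeyer_eq[OF assms] szasz_basis_weight_eq P_def c_def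
    by (rule suminf_mult[OF sc[unfolded c_def]])
  have "diffs (c j) k = real n * c (j - 1) k" for k
  proof -
    have "durrmeyer_weight n j f (Suc k) = durrmeyer_weight n (j - 1) f k"
      by (auto simp: durrmeyer_weight_def algebra_simps)
    then show ?thesis by (simp add: diffs_def c_def field_simps del: of_nat_Suc)
  qed
  then have "(\<Sum>k. diffs (c j) k * y ^ k) = real n * P (j - 1) y"
    unfolding P_def using suminf_mult[OF sc[of "j - 1" y], of "real n"] by (simp add: mult.assoc)
  then have "(P j has_real_derivative real n * P (j - 1) y) (at y)"
    using termdiffs_strong_converges_everywhere[of "c j" y] sc unfolding P_def by simp
  then show ?thesis
    unfolding S[abs_def] by (auto intro!: derivative_eq_intros simp: algebra_simps)
qed

lemma szasz_durrmeyer_add: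
  assumes "f \<in> exp_space A" "g \<in> exp_space A" "real n > A" "A \<ge> 0"
  shows "szasz_durrmeyer n j (\<lambda>t. f t + g t) y = szasz_durrmeyer n j f y + szasz_durrmeyer n j g y"
  unfolding szasz_durrmeyer_eq[OF assms(1,3,4)] szasz_durrmeyer_eq[OF assms(2,3,4)]
    szasz_durrmeyer_eq[OF exp_space_add[OF assms(1,2)] assms(3,4)] durrmeyer_weight_add[OF assms] distrib_left
  by (rule suminf_add[symmetric, OF summable_durrmeyer[OF assms(1,3,4)] summable_durrmeyer[OF assms(2-4)]])

lemma szasz_durrmeyer_cmult:
  assumes "f \<in> exp_space A" "real n > A" "A \<ge> 0"
  shows "szasz_durrmeyer n j (\<lambda>t. c * f t) y = c * szasz_durrmeyer n j f y"
  unfolding szasz_durrmeyer_eq[OF assms] szasz_durrmeyer_eq[OF exp_space_cmult[OF assms(1)] assms(2,3)]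
    durrmeyer_weight_cmult mult.left_commute[of _ c]
  by (intro suminf_mult summable_durrmeyer[OF assms])

lemma szasz_durrmeyer_abs_le:
  assumes "f \<in> exp_space A" "g \<in> exp_space A" "real n > A" "A \<ge> 0" "y \<ge> 0"
    and le: "\<And>t. t \<ge> 0 \<Longrightarrow> \<bar>f t\<bar> \<le> g t"
  shows "\<bar>szasz_durrmeyer n j f y\<bar> \<le> szasz_durrmeyer n j g y"
proof -
  have "norm (szasz_basis n (int k) y * durrmeyer_weight n j f k) \<le> szasz_basis n (int k) y * durrmeyer_weight n j g k" for k
    using szasz_basis_nonneg[OF assms(5), of n "int k"] durrmeyer_weight_abs_le[OF assms(1-4) le]
    by (simp add: abs_mult mult_left_mono)
  from norm_suminf_le[OF this summable_durrmeyer[OF assms(2-4)]] show ?thesis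
    unfolding szasz_durrmeyer_eq[OF assms(1,3,4)] szasz_durrmeyer_eq[OF assms(2,3,4)] by simp
qed

lemma szasz_basis_geometric_sums:
  "(\<lambda>k. szasz_basis n (int k) y * r ^ k) sums exp (real n * y * (r - 1))"
proof -
  have "(\<lambda>k. exp (- (real n * y)) * ((real n * y * r) ^ k /\<^sub>R fact k)) sums (exp (- (real n * y)) * exp (real n * y * r))"
    by (intro sums_mult exp_converges)
  also have "exp (- (real n * y)) * exp (real n * y * r) = exp (real n * y * (r - 1))"
    by (simp add: exp_add[symmetric] algebra_simps)
  also have "(\<lambda>k. exp (- (real n * y)) * ((real n * y * r) ^ k /\<^sub>R fact k)) = (\<lambda>k. szasz_basis n (int k) y * r ^ k)"
    unfolding power_mult_distrib by (simp add: szasz_basis_def field_simps)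
  finally show ?thesis .
qed

text \<open>The factor \<open>n / (n - A)\<close> is at most \<open>2\<close> here, and the Poisson series of its powers is
  the exponential of \<open>n y (n / (n - A) - 1) = y A n / (n - A)\<close>, hence at most
  the exponential of \<open>2 A y\<close>.\<close>
lemma szasz_durrmeyer_exp_bounded:
  assumes "A \<ge> 0" "y \<ge> 0" "n > 0" "real n \<ge> 2 * A"
  shows "szasz_durrmeyer n j (\<lambda>t. exp (A * t)) y \<le> 2 ^ nat (1 - j) * exp (2 * A * y)"
proof -
  have n: "real n > A" using assms by (cases "A = 0") auto
  define r where "r = real n / (real n - A)"
  have r: "r \<ge> 0" "r \<le> 2" "real n * (r - 1) \<le> 2 * A"
  proof -
    show "r \<ge> 0" "r \<le> 2" using n assms by (auto simp: r_def field_simps)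
    have "real n * (r - 1) = r * A" using n by (simp add: r_def field_simps)
    also have "\<dots> \<le> 2 * A" using \<open>r \<le> 2\<close> assms(1) by (rule mult_right_mono)
    finally show "real n * (r - 1) \<le> 2 * A" .
  qed
  have s: "(\<lambda>k. r ^ nat (1 - j) * (szasz_basis n (int k) y * r ^ k)) sums (r ^ nat (1 - j) * exp (real n * y * (r - 1)))"
    by (intro sums_mult szasz_basis_geometric_sums)
  have "szasz_durrmeyer n j (\<lambda>t. exp (A * t)) y \<le> (\<Sum>k. r ^ nat (1 - j) * (szasz_basis n (int k) y * r ^ k))"
    unfolding szasz_durrmeyer_eq[OF exp_exp_space n assms(1)]
  proof (intro suminf_le summable_durrmeyer[OF exp_exp_space n assms(1)] sums_summable[OF s])
    fix k
    have "szasz_basis n (int k) y * durrmeyer_weight n j (\<lambda>t. exp (A * t)) k \<le> szasz_basis n (int k) y * r ^ (k + nat (1 - j))"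
      unfolding r_def by (intro mult_left_mono durrmeyer_weight_exp_le n assms szasz_basis_nonneg)
    then show "szasz_basis n (int k) y * durrmeyer_weight n j (\<lambda>t. exp (A * t)) k \<le> r ^ nat (1 - j) * (szasz_basis n (int k) y * r ^ k)"
      by (simp add: power_add mult_ac)
  qed
  also have "\<dots> = r ^ nat (1 - j) * exp (real n * y * (r - 1))" using s by (rule sums_unique[symmetric])
  also have "\<dots> \<le> 2 ^ nat (1 - j) * exp (2 * A * y)"
  proof (intro mult_mono power_mono r)
    show "exp (real n * y * (r - 1)) \<le> exp (2 * A * y)"
      using mult_right_mono[OF r(3) assms(2)] by (simp add: mult_ac)
  qed (use r in auto)
  finally show ?thesis .
qed

section \<open>Expansion on polynomials\<close>

text \<open>The factorial moments of the Poisson distribution: the binomial coefficient cancels part of the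
  factorial in the basis function, which leaves a Poisson distribution shifted by \<open>l\<close>.\<close>
lemma szasz_basis_binomial_sums:
  "(\<lambda>k. szasz_basis n (int k) y * real (k choose l)) sums ((real n * y) ^ l / fact l)"
proof -
  have "(\<lambda>i. szasz_basis n (int (i + l)) y * real ((i + l) choose l)) sums ((real n * y) ^ l / fact l)"
  proof -
    have "(\<lambda>i. (real n * y) ^ l / fact l * (szasz_basis n (int i) y * 1 ^ i)) sums ((real n * y) ^ l / fact l * exp (real n * y * (1 - 1)))"
      by (intro sums_mult szasz_basis_geometric_sums)
    moreover have "szasz_basis n (int (i + l)) y * real ((i + l) choose l) = (real n * y) ^ l / fact l * (szasz_basis n (int i) y * 1 ^ i)" for i
      by (simp add: szasz_basis_def binomial_fact power_add field_simps del: of_nat_add)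
    ultimately show ?thesis by simp
  qed
  moreover have "(\<Sum>i<l. szasz_basis n (int i) y * real (i choose l)) = 0"
    by (intro sum.neutral) (auto simp: binomial_eq_0)
  ultimately show ?thesis
    using sums_iff_shift[of "\<lambda>k. szasz_basis n (int k) y * real (k choose l)" l "(real n * y) ^ l / fact l"] by simp
qed

lemma smallo_ev_cong:
  assumes "f \<in> o[F](h)" "\<forall>\<^sub>F n in F. g n = f n"
  shows "g \<in> o[F](h)"
  using assms landau_o.small.in_cong by blast

lemma voronovskaja_coeff_add:
  "voronovskaja_coeff m j k (\<lambda>s. d s + e s) x = voronovskaja_coeff m j k d x + voronovskaja_coeff m j k e x"
  unfolding voronovskaja_coeff_def by (simp add: distrib_left sum.distrib)

lemma voronovskaja_coeff_cmult:
  "voronovskaja_coeff m j k (\<lambda>s. c * d s) x = c * voronovskaja_coeff m j k d x"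
  unfolding voronovskaja_coeff_def by (simp add: sum_distrib_left mult_ac)

definition poly_jet :: "real poly \<Rightarrow> real \<Rightarrow> nat \<Rightarrow> real" where
  "poly_jet p x s = poly ((pderiv ^^ s) p) x"

text \<open>Vandermonde's convolution collapses the sum over \<open>i\<close>.\<close>
lemma voronovskaja_coeff_monom:
  "voronovskaja_coeff 0 j k (poly_jet ([:0, 1:] ^ r) x) x =
     (if k \<le> r then fact r / fact (r - k) * (real_of_int (int r - j) gchoose k) * x ^ (r - k) else 0)"
proof -
  have jet: "poly_jet ([:0, 1:] ^ r) x s = (if s \<le> r then fact r / fact (r - s) * x ^ (r - s) else 0)" for s
    unfolding poly_jet_def using poly_higher_pderiv_linear_power[of s 0 r x] by simp
  show ?thesis
  proof (cases "k \<le> r")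
    case False
    then show ?thesis by (simp add: voronovskaja_coeff_def jet)
  next
    case True
    have "voronovskaja_coeff 0 j k (poly_jet ([:0, 1:] ^ r) x) x =
       (\<Sum>i=0..k. fact r / fact (r - k) * x ^ (r - k) * ((of_nat (r - k) gchoose i) * (real_of_int (int k - j) gchoose (k - i))))"
      unfolding voronovskaja_coeff_def
    proof (intro sum.cong refl)
      fix i assume "i \<in> {0..k}"
      show "1 / fact i * (real_of_int (int k + int 0 - j) gchoose (k - i)) * x ^ i * poly_jet ([:0, 1:] ^ r) x (k + 0 + i) =
         fact r / fact (r - k) * x ^ (r - k) * ((of_nat (r - k) gchoose i) * (real_of_int (int k - j) gchoose (k - i)))"
      proof (cases "k + i \<le> r")
        case True
        then have p: "x ^ (r - k) = x ^ i * x ^ (r - (k + i))" 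
          by (simp flip: power_add)
        have b: "(of_nat (r - k) gchoose i :: real) = fact (r - k) / (fact i * fact (r - (k + i)))"
          unfolding binomial_gbinomial[symmetric] using True by (simp add: binomial_fact)
        show ?thesis using True unfolding jet p b by simp
      next
        case False
        with \<open>k \<le> r\<close> have "r - k < i" by linarith
        then have "(of_nat (r - k) gchoose i :: real) = 0"
          unfolding binomial_gbinomial[symmetric] by simp
        then show ?thesis using False by (simp add: jet)
      qed
    qed
    also have "\<dots> = fact r / fact (r - k) * x ^ (r - k) * ((real (r - k) + real_of_int (int k - j)) gchoose k)"
      unfolding sum_distrib_left[symmetric] gbinomial_Vandermonde ..
    also have "real (r - k) + real_of_int (int k - j) = real_of_int (int r - j)"
      using True by (simp add: of_nat_diff)
    finally show ?thesis using True by simp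
  qed
qed

lemma inverse_power_smallo:
  assumes "q < k"
  shows "(\<lambda>n. c / real n ^ k) \<in> o[sequentially](\<lambda>n. 1 / real n ^ q)"
proof (rule smalloI_tendsto)
  have "(\<lambda>n. c * (1 / real n) ^ (k - q)) \<longlonglongrightarrow> c * 0 ^ (k - q)"
    by (intro tendsto_intros lim_1_over_n)
  moreover have "c * 0 ^ (k - q) = 0" using assms by simp
  ultimately have "(\<lambda>n. c * (1 / real n) ^ (k - q)) \<longlonglongrightarrow> 0" by (simp only:)
  moreover have "\<forall>\<^sub>F n in sequentially. c * (1 / real n) ^ (k - q) = c / real n ^ k / (1 / real n ^ q)"
    using eventually_gt_at_top[of 0]
  proof eventually_elim
    case (elim n)
    have "real n ^ k = real n ^ q * real n ^ (k - q)" using assms by (simp flip: power_add)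
    then show ?case using elim by (simp add: power_divide)
  qed
  ultimately show "(\<lambda>n. c / real n ^ k / (1 / real n ^ q)) \<longlonglongrightarrow> 0"
    by (rule Lim_transform_eventually)
  show "\<forall>\<^sub>F n in sequentially. 1 / real n ^ q \<noteq> 0"
    using eventually_gt_at_top[of 0] by eventually_elim simp
qed

text \<open>For a fixed index, a Poisson probability with parameter \<open>n x\<close> is exponentially small. These are the
  terms by which the operators differ from a rational expression in \<open>n\<close> on polynomials. The second factor
  has a limit for every \<open>r\<close>, including \<open>r = 0\<close>.\<close>
lemma szasz_basis_exp_small:
  assumes "x > 0"
  shows "(\<lambda>n. szasz_basis n (int k) x * (a - b / real n ^ r)) \<in> o[sequentially](\<lambda>n. 1 / real n ^ q)"
proof (rule smalloI_tendsto)
  have "filterlim (\<lambda>n. real n * x) at_top sequentially"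
    using assms by (intro filterlim_at_top_mult_tendsto_pos[OF tendsto_const] filterlim_real_sequentially)
  from filterlim_compose[OF tendsto_power_div_exp_0 this, of "k + q"]
  have "(\<lambda>n. (real n * x) ^ (k + q) / exp (real n * x) * (1 / (fact k * x ^ q)) * (a - b * (1 / real n) ^ r)) \<longlonglongrightarrow>
      0 * (1 / (fact k * x ^ q)) * (a - b * 0 ^ r)"
    by (intro tendsto_intros lim_1_over_n)
  then have "(\<lambda>n. (real n * x) ^ (k + q) / exp (real n * x) * (1 / (fact k * x ^ q)) * (a - b * (1 / real n) ^ r)) \<longlonglongrightarrow> 0"
    by simp
  also have "(\<lambda>n. (real n * x) ^ (k + q) / exp (real n * x) * (1 / (fact k * x ^ q)) * (a - b * (1 / real n) ^ r)) =
     (\<lambda>n. szasz_basis n (int k) x * (a - b / real n ^ r) / (1 / real n ^ q))"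
    using assms by (simp add: szasz_basis_def power_divide power_add power_mult_distrib exp_minus field_simps)
  finally show "(\<lambda>n. szasz_basis n (int k) x * (a - b / real n ^ r) / (1 / real n ^ q)) \<longlonglongrightarrow> 0" .
  show "\<forall>\<^sub>F n in sequentially. 1 / real n ^ q \<noteq> 0"
    using eventually_gt_at_top[of 0] by eventually_elim simp
qed

text \<open>The rising factorial is \<open>r!\<close> times a binomial coefficient of \<open>k + (r - j)\<close>, which Vandermonde's
  convolution expands into binomial coefficients of \<open>k\<close>, whose Poisson means are known.\<close>
lemma szasz_basis_pochhammer_sums:
  assumes "n > 0"
  shows "(\<lambda>k. szasz_basis n (int k) x * (pochhammer (real_of_int (int k - j) + 1) r / real n ^ r)) sums
    (\<Sum>k\<le>r. voronovskaja_coeff 0 j k (poly_jet ([:0, 1:] ^ r) x) x / real n ^ k)"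
proof -
  define b where "b = (\<lambda>l. real_of_int (int r - j) gchoose (r - l))"
  have poch: "pochhammer (real_of_int (int k - j) + 1) r = (\<Sum>l=0..r. fact r * b l * real (k choose l))" for k
  proof -
    have "pochhammer (real_of_int (int k - j) + 1) r = fact r * ((real k + real_of_int (int r - j)) gchoose r)"
      unfolding gbinomial_pochhammer' by (simp add: algebra_simps)
    also have "\<dots> = fact r * (\<Sum>l=0..r. (real k gchoose l) * b l)"
      unfolding b_def gbinomial_Vandermonde ..
    finally show ?thesis by (simp add: binomial_gbinomial sum_distrib_left mult_ac)
  qed
  have "(\<lambda>k. \<Sum>l=0..r. fact r * b l / real n ^ r * (szasz_basis n (int k) x * real (k choose l))) sums
     (\<Sum>l=0..r. fact r * b l / real n ^ r * ((real n * x) ^ l / fact l))"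
    by (intro sums_sum sums_mult szasz_basis_binomial_sums)
  also have "(\<lambda>k. \<Sum>l=0..r. fact r * b l / real n ^ r * (szasz_basis n (int k) x * real (k choose l))) =
    (\<lambda>k. szasz_basis n (int k) x * (pochhammer (real_of_int (int k - j) + 1) r / real n ^ r))"
    unfolding poch by (simp add: sum_distrib_left sum_divide_distrib mult_ac)
  also have "(\<Sum>l=0..r. fact r * b l / real n ^ r * ((real n * x) ^ l / fact l)) =
     (\<Sum>k=0..r. fact r * b (r - k) / real n ^ r * ((real n * x) ^ (r - k) / fact (r - k)))"
    by (subst sum.atLeastAtMost_rev) simp
  also have "\<dots> = (\<Sum>k\<le>r. voronovskaja_coeff 0 j k (poly_jet ([:0, 1:] ^ r) x) x / real n ^ k)"
    unfolding atLeast0AtMost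
  proof (intro sum.cong refl)
    fix k assume "k \<in> {..r}"
    then have k: "k \<le> r" by simp
    then have "real n ^ r = real n ^ k * real n ^ (r - k)" by (simp flip: power_add)
    then show "fact r * b (r - k) / real n ^ r * ((real n * x) ^ (r - k) / fact (r - k)) =
      voronovskaja_coeff 0 j k (poly_jet ([:0, 1:] ^ r) x) x / real n ^ k"
      using k assms unfolding voronovskaja_coeff_monom by (simp add: b_def power_mult_distrib mult_ac)
  qed
  finally show ?thesis .
qed

text \<open>The gamma mean of \<open>t ^ r\<close> is a rising factorial in \<open>k - j\<close>. Extending it to the places \<open>k < j\<close>, where
  the weight is the value \<open>0 ^ r\<close> at the origin, costs an exponentially small error.\<close>
lemma szasz_durrmeyer_monom_expansion:
  assumes "x > 0"
  shows "(\<lambda>n. szasz_durrmeyer n j (poly ([:0, 1:] ^ r)) x -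
     (\<Sum>k\<le>q. voronovskaja_coeff 0 j k (poly_jet ([:0, 1:] ^ r) x) x / real n ^ k)) \<in> o[sequentially](\<lambda>n. 1 / real n ^ q)"
proof -
  let ?v = "\<lambda>k. voronovskaja_coeff 0 j k (poly_jet ([:0, 1:] ^ r) x) x"
  let ?P = "\<lambda>k. pochhammer (real_of_int (int k - j) + 1) r"
  \<comment> \<open>\<open>?E\<close> corrects the weights at the places \<open>k < j\<close>; \<open>?T\<close> holds the terms beyond order \<open>q\<close>. The range
    up to \<open>q + r\<close> contains both \<open>{..q}\<close> and \<open>{..r}\<close>, and the coefficients vanish for \<open>k > r\<close>.\<close>
  let ?E = "\<lambda>n. (\<Sum>k<nat j. szasz_basis n (int k) x * (0 ^ r - ?P k / real n ^ r))"
  let ?T = "\<lambda>n. (\<Sum>k\<in>{q<..q + r}. ?v k / real n ^ k)"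
  have "(\<lambda>n. ?E n + ?T n) \<in> o[sequentially](\<lambda>n. 1 / real n ^ q)"
    by (intro sum_in_smallo big_sum_in_smallo szasz_basis_exp_small assms inverse_power_smallo) simp
  moreover have "\<forall>\<^sub>F n in sequentially. szasz_durrmeyer n j (poly ([:0, 1:] ^ r)) x - (\<Sum>k\<le>q. ?v k / real n ^ k) = ?E n + ?T n"
    using eventually_gt_at_top[of 1]
  proof eventually_elim
    case (elim n)
    have p: "poly ([:0, 1:] ^ r) = (\<lambda>t::real. t ^ r)" by (simp add: fun_eq_iff)
    have sp: "(\<lambda>t::real. t ^ r) \<in> exp_space 1" using poly_exp_space[of 1 "[:0, 1:] ^ r"] p by simp
    have n: "real n > 1" using elim by simp
    let ?w = "durrmeyer_weight n j (\<lambda>t. t ^ r)"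
    have w: "?w k = (if k < nat j then 0 ^ r else ?P k / real n ^ r)" for k
      using elim by (auto simp: durrmeyer_weight_def gamma_mean_power)
    have "(\<lambda>k. szasz_basis n (int k) x * (?P k / real n ^ r) + (if k < nat j then szasz_basis n (int k) x * (0 ^ r - ?P k / real n ^ r) else 0))
      sums ((\<Sum>k\<le>r. ?v k / real n ^ k) + ?E n)"
      using sums_If_finite_set[of "{..<nat j}" "\<lambda>k. szasz_basis n (int k) x * (0 ^ r - ?P k / real n ^ r)"] elim
      by (intro sums_add szasz_basis_pochhammer_sums) auto
    also have "(\<lambda>k. szasz_basis n (int k) x * (?P k / real n ^ r) + (if k < nat j then szasz_basis n (int k) x * (0 ^ r - ?P k / real n ^ r) else 0)) =
       (\<lambda>k. szasz_basis n (int k) x * ?w k)"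
      unfolding w by (auto simp: fun_eq_iff algebra_simps)
    finally have S: "szasz_durrmeyer n j (poly ([:0, 1:] ^ r)) x = (\<Sum>k\<le>r. ?v k / real n ^ k) + ?E n"
      unfolding p szasz_durrmeyer_eq[OF sp n zero_le_one] by (rule sums_unique[symmetric])
    have "(\<Sum>k\<le>r. ?v k / real n ^ k) = (\<Sum>k\<le>q + r. ?v k / real n ^ k)"
      by (rule sum.mono_neutral_left) (auto simp: voronovskaja_coeff_monom)
    also have "\<dots> = (\<Sum>k\<le>q. ?v k / real n ^ k) + ?T n"
      by (subst sum.union_disjoint[symmetric]) (auto intro: sum.cong)
    finally show ?case unfolding S by simp
  qed
  ultimately show ?thesis by (rule smallo_ev_cong)
qed

lemma szasz_durrmeyer_poly_expansion:
  assumes "x > 0"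
  shows "(\<lambda>n. szasz_durrmeyer n j (poly p) x -
     (\<Sum>k\<le>q. voronovskaja_coeff 0 j k (poly_jet p x) x / real n ^ k)) \<in> o[sequentially](\<lambda>n. 1 / real n ^ q)"
proof -
  define R where "R = (\<lambda>p n. szasz_durrmeyer n j (poly p) x -
     (\<Sum>k\<le>q. voronovskaja_coeff 0 j k (poly_jet p x) x / real n ^ k))"
  note ps = poly_exp_space[OF order_refl]
  have add: "R (p1 + p2) n = R p1 n + R p2 n" if "n > 1" for p1 p2 n
  proof -
    have "poly (p1 + p2) = (\<lambda>t. poly p1 t + poly p2 t)" by auto
    moreover have "poly_jet (p1 + p2) x = (\<lambda>s. poly_jet p1 x s + poly_jet p2 x s)"
      by (auto simp: poly_jet_def higher_pderiv_add)
    ultimately show ?thesis using szasz_durrmeyer_add[OF ps ps, where n = n and j = j and y = x] that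
      by (simp add: R_def voronovskaja_coeff_add add_divide_distrib sum.distrib)
  qed
  have cmult: "R (smult c p1) n = c * R p1 n" if "n > 1" for c p1 n
  proof -
    have "poly (smult c p1) = (\<lambda>t. c * poly p1 t)" by auto
    moreover have "poly_jet (smult c p1) x = (\<lambda>s. c * poly_jet p1 x s)"
      by (auto simp: poly_jet_def higher_pderiv_smult)
    ultimately show ?thesis using szasz_durrmeyer_cmult[OF ps, where n = n and j = j and y = x] that
      by (simp add: R_def voronovskaja_coeff_cmult right_diff_distrib sum_distrib_left)
  qed
  have monom: "R (smult c ([:0, 1:] ^ r)) \<in> o[sequentially](\<lambda>n. 1 / real n ^ q)" for c r
  proof -
    have "(\<lambda>n. c * R ([:0, 1:] ^ r) n) \<in> o[sequentially](\<lambda>n. 1 / real n ^ q)"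
      using szasz_durrmeyer_monom_expansion[OF assms] unfolding R_def by (cases "c = 0") auto
    moreover have "\<forall>\<^sub>F n in sequentially. R (smult c ([:0, 1:] ^ r)) n = c * R ([:0, 1:] ^ r) n"
      using eventually_gt_at_top[of 1] by eventually_elim (rule cmult)
    ultimately show ?thesis by (rule smallo_ev_cong)
  qed
  have sum: "R (\<Sum>r\<le>N. smult (coeff p r) ([:0, 1:] ^ r)) \<in> o[sequentially](\<lambda>n. 1 / real n ^ q)" for N
  proof (induction N)
    case 0
    show ?case using monom[of "coeff p 0" 0] by simp
  next
    case (Suc N)
    let ?p1 = "\<Sum>r\<le>N. smult (coeff p r) ([:0, 1:] ^ r)" and ?p2 = "smult (coeff p (Suc N)) ([:0, 1:] ^ Suc N)"
    have "(\<lambda>n. R ?p1 n + R ?p2 n) \<in> o[sequentially](\<lambda>n. 1 / real n ^ q)"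
      by (intro sum_in_smallo monom Suc)
    moreover have "\<forall>\<^sub>F n in sequentially. R (?p1 + ?p2) n = R ?p1 n + R ?p2 n"
      using eventually_gt_at_top[of 1] by eventually_elim (rule add)
    ultimately show ?case unfolding sum.atMost_Suc by (rule smallo_ev_cong)
  qed
  have "(\<Sum>r\<le>degree p. smult (coeff p r) ([:0, 1:] ^ r)) = p"
    using poly_as_sum_of_monoms[of p] by (simp add: monom_altdef)
  then show ?thesis using sum[of "degree p"] unfolding R_def by simp
qed

text \<open>At \<open>x\<close> only the derivative of order \<open>2 p\<close> of \<open>(t - x) ^ (2 p)\<close> is nonzero, and the coefficient with
  index \<open>k\<close> involves derivatives of order at most \<open>2 k\<close>; so the expansion starts with \<open>n\<^sup>-\<^sup>p\<close>.\<close>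
lemma szasz_durrmeyer_central_moment:
  assumes "x > 0"
  shows "(\<lambda>n. szasz_durrmeyer n j (\<lambda>t. (t - x) ^ (2 * p)) x) \<in> O[sequentially](\<lambda>n. 1 / real n ^ p)"
proof -
  let ?p = "[:- x, 1:] ^ (2 * p)"
  let ?v = "\<lambda>k. voronovskaja_coeff 0 j k (poly_jet ?p x) x"
  have pe: "poly ?p = (\<lambda>t. (t - x) ^ (2 * p))" by (simp add: fun_eq_iff)
  have "?v k = 0" if "k < p" for k
    unfolding voronovskaja_coeff_def using that
    by (intro sum.neutral) (auto simp: poly_jet_def poly_higher_pderiv_linear_power)
  then have v: "(\<Sum>k\<le>p. ?v k / real n ^ k) = ?v p / real n ^ p" for n
    by (subst sum.mono_neutral_right[of _ "{p}"]) auto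
  have "(\<lambda>n. szasz_durrmeyer n j (poly ?p) x - ?v p / real n ^ p) \<in> O[sequentially](\<lambda>n. 1 / real n ^ p)"
    using szasz_durrmeyer_poly_expansion[OF assms, of j ?p p] unfolding v by (rule landau_o.small_imp_big)
  moreover have "(\<lambda>n. ?v p / real n ^ p) \<in> O[sequentially](\<lambda>n. 1 / real n ^ p)"
    by (intro bigoI[of _ "\<bar>?v p\<bar>"]) (auto intro: always_eventually)
  ultimately have "(\<lambda>n. (szasz_durrmeyer n j (poly ?p) x - ?v p / real n ^ p) + ?v p / real n ^ p) \<in> O[sequentially](\<lambda>n. 1 / real n ^ p)"
    by (rule sum_in_bigo)
  then show ?thesis by (simp add: pe)
qed

section \<open>Localization\<close>

text \<open>Away from \<open>x\<close> the function is bounded by an exponential. Instead of estimating the operator on the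
  product of an exponential and a high power of \<open>t - x\<close>, the inequality
  \<open>a \<le> a\<^sup>2 / \<mu> + \<mu>\<close> separates the two factors; the parameter \<open>\<mu>\<close> may later depend on \<open>n\<close>.\<close>
lemma remainder_split_bound:
  fixes R :: "real \<Rightarrow> real"
  assumes near: "\<And>t. \<bar>t - x\<bar> < \<delta> \<Longrightarrow> \<bar>R t\<bar> \<le> e * (t - x) ^ (2 * q)"
    and far: "\<And>t. t \<ge> 0 \<Longrightarrow> \<bar>R t\<bar> \<le> K * exp (A * t)"
    and "\<delta> > 0" "K > 0" "e > 0" "\<mu> > 0" "t \<ge> 0"
  shows "\<bar>R t\<bar> \<le> e * (t - x) ^ (2 * q) + 
    (K / \<mu> * exp (2 * A * t) + K * \<mu> / \<delta> ^ (2 * s) * (t - x) ^ (2 * s))"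
proof (cases "\<bar>t - x\<bar> < \<delta>")
  case True
  have "0 \<le> K / \<mu> * exp (2 * A * t) + K * \<mu> / \<delta> ^ (2 * s) * (t - x) ^ (2 * s)"
    using assms by (intro add_nonneg_nonneg mult_nonneg_nonneg divide_nonneg_pos) (auto simp: zero_le_even_power)
  then show ?thesis using near[OF True] by linarith
next
  case False
  have 1: "1 \<le> (t - x) ^ (2 * s) / \<delta> ^ (2 * s)"
  proof -
    have "\<delta> ^ (2 * s) \<le> \<bar>t - x\<bar> ^ (2 * s)" using False assms(3) by (intro power_mono) auto
    then show ?thesis using assms(3) by (simp add: power_even_abs)
  qed
  have 2: "exp (A * t) \<le> exp (A * t) ^ 2 / \<mu> + \<mu>"
  proof -
    have "0 \<le> (exp (A * t) - \<mu>) ^ 2" "0 \<le> exp (A * t) * \<mu>" using assms by auto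
    then have "exp (A * t) * \<mu> \<le> exp (A * t) ^ 2 + \<mu> * \<mu>" 
      by (simp add: power2_eq_square algebra_simps)
    then show ?thesis using assms by (simp add: field_simps)
  qed
  have 3: "\<mu> \<le> \<mu> * ((t - x) ^ (2 * s) / \<delta> ^ (2 * s))"
    using mult_left_mono[OF 1, of \<mu>] assms by simp
  have 4: "exp (A * t) ^ 2 = exp (2 * A * t)"
    by (simp add: power2_eq_square flip: exp_add)
  have "exp (A * t) \<le> exp (2 * A * t) / \<mu> + \<mu> * ((t - x) ^ (2 * s) / \<delta> ^ (2 * s))"
    using 2[unfolded 4] 3 by linarith
  then have "K * exp (A * t) \<le> K * (exp (2 * A * t) / \<mu> + \<mu> * ((t - x) ^ (2 * s) / \<delta> ^ (2 * s)))"
    using assms by (intro mult_left_mono) auto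
  moreover have "0 \<le> e * (t - x) ^ (2 * q)" using assms by (simp add: zero_le_even_power)
  ultimately show ?thesis using far[OF assms(7)] by (simp add: distrib_left mult_ac)
qed

text \<open>The split bound is used with \<open>\<mu> = n ^ (q + 1)\<close> and the even power \<open>2 s = 4 q + 4\<close>: the exponential
  then contributes \<open>O(n\<^sup>-\<^sup>q\<^sup>-\<^sup>1)\<close> and the high power
  \<open>n ^ (q + 1) O(n ^ (- 2 q - 2))\<close>, which is of the same order.\<close>
lemma szasz_durrmeyer_localization:
  assumes x: "x > 0" and R: "R \<in> exp_space A" and A: "A \<ge> 1"
    and small: "\<And>e. e > 0 \<Longrightarrow> \<forall>\<^sub>F t in nhds x. \<bar>R t\<bar> \<le> e * (t - x) ^ (2 * q)"
  shows "(\<lambda>n. szasz_durrmeyer n j R x) \<in> o[sequentially](\<lambda>n. 1 / real n ^ q)"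
proof (rule landau_o.smallI)
  fix c :: real assume c: "c > 0"
  let ?S = "\<lambda>n g. szasz_durrmeyer n j g x"
  \<comment> \<open>The term with the factor \<open>e\<close> takes half of \<open>c\<close>; the constant \<open>D\<close> below collects the contributions of order
    \<open>n\<^sup>-\<^sup>q\<^sup>-\<^sup>1\<close>, which eventually fit into the other half.\<close>
  define s where "s = 2 * q + 2"
  define B where "B = 2 * A"
  have B: "B \<ge> 1" "B \<ge> 0" "A \<le> B" using A by (auto simp: B_def)
  obtain M1 where M1: "M1 > 0"
    "\<forall>\<^sub>F n in sequentially. norm (?S n (\<lambda>t. (t - x) ^ (2 * q))) \<le> M1 * norm (1 / real n ^ q)"
    by (rule landau_o.bigE[OF szasz_durrmeyer_central_moment[OF x]])
  obtain M2 where M2: "M2 > 0"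
    "\<forall>\<^sub>F n in sequentially. norm (?S n (\<lambda>t. (t - x) ^ (2 * s))) \<le> M2 * norm (1 / real n ^ s)"
    by (rule landau_o.bigE[OF szasz_durrmeyer_central_moment[OF x]])
  define M3 where "M3 = (2 ^ nat (1 - j) * exp (2 * B * x) :: real)"
  define e where "e = c / (2 * M1)"
  have e: "e > 0" "e * M1 = c / 2" using c M1(1) by (auto simp: e_def)
  obtain K where K: "K > 0" "\<And>t. t \<ge> 0 \<Longrightarrow> \<bar>R t\<bar> \<le> K * exp (A * t)"
    using exp_spaceD[OF R] by blast
  obtain \<delta> where \<delta>: "\<delta> > 0" "\<And>t. \<bar>t - x\<bar> < \<delta> \<Longrightarrow> \<bar>R t\<bar> \<le> e * (t - x) ^ (2 * q)"
    using small[OF e(1)] unfolding eventually_nhds_metric dist_real_def by blast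
  define D where "D = K * M3 + K / \<delta> ^ (2 * s) * M2"
  have "\<forall>\<^sub>F n in sequentially. norm (D / real n ^ (q + 1)) \<le> c / 2 * norm (1 / real n ^ q)"
    by (rule landau_o.smallD[OF inverse_power_smallo]) (use c in auto)
  then show "\<forall>\<^sub>F n in sequentially. norm (?S n R) \<le> c * norm (1 / real n ^ q)"
    using M1(2) M2(2) eventually_gt_at_top[of 0] eventually_ge_at_top[of "nat \<lceil>2 * B\<rceil>"]
  proof eventually_elim
    case (elim n)
    have n: "n > 0" "real n \<ge> 2 * B" "real n > B" using elim B by linarith+
    let ?l = "real n ^ (q + 1)"
    let ?f1 = "\<lambda>t. e * (t - x) ^ (2 * q)" and ?f2 = "\<lambda>t. K / ?l * exp (B * t)" and ?f3 = "\<lambda>t. K * ?l / \<delta> ^ (2 * s) * (t - x) ^ (2 * s)"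
    note mem = centered_power_exp_space[OF B(1)] exp_exp_space
    have m1: "?f1 \<in> exp_space B" and m2: "?f2 \<in> exp_space B" and m3: "?f3 \<in> exp_space B"
      by (intro exp_space_cmult mem)+
    have "\<bar>?S n R\<bar> \<le> ?S n (\<lambda>t. ?f1 t + (?f2 t + ?f3 t))"
    proof (rule szasz_durrmeyer_abs_le[OF exp_space_mono[OF R B(3)] exp_space_add[OF m1 exp_space_add[OF m2 m3]] n(3) B(2)])
      fix t :: real assume "t \<ge> 0"
      then show "\<bar>R t\<bar> \<le> ?f1 t + (?f2 t + ?f3 t)"
        unfolding B_def using remainder_split_bound[OF \<delta>(2) K(2) \<delta>(1) K(1) e(1), of ?l t] n(1) by simp
    qed (use x in simp)
    also have "\<dots> = e * ?S n (\<lambda>t. (t - x) ^ (2 * q)) + (K / ?l * ?S n (\<lambda>t. exp (B * t)) + 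
        K * ?l / \<delta> ^ (2 * s) * ?S n (\<lambda>t. (t - x) ^ (2 * s)))"
      unfolding szasz_durrmeyer_add[OF m1 exp_space_add[OF m2 m3] n(3) B(2)] szasz_durrmeyer_add[OF m2 m3 n(3) B(2)]
        szasz_durrmeyer_cmult[OF mem(1) n(3) B(2)] szasz_durrmeyer_cmult[OF mem(2) n(3) B(2)] ..
    also have "\<dots> \<le> e * (M1 * (1 / real n ^ q)) + (K / ?l * M3 + K * ?l / \<delta> ^ (2 * s) * (M2 * (1 / real n ^ s)))"
    proof (intro add_mono mult_left_mono)
      show "?S n (\<lambda>t. exp (B * t)) \<le> M3"
        unfolding M3_def using szasz_durrmeyer_exp_bounded[OF B(2) _ n(1,2)] x by simp
    qed (use elim e K \<delta> in auto)
    also have "\<dots> = c / 2 * (1 / real n ^ q) + D / ?l"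
    proof -
      have "real n ^ s = ?l * ?l" by (simp add: s_def power_add[symmetric] mult_2)
      then have "K * ?l / \<delta> ^ (2 * s) * (M2 * (1 / real n ^ s)) = K / \<delta> ^ (2 * s) * M2 / ?l"
        using n(1) by (simp add: field_simps)
      moreover have "e * (M1 * (1 / real n ^ q)) = c / 2 * (1 / real n ^ q)"
        unfolding mult.assoc[symmetric] e(2) ..
      ultimately show ?thesis by (simp add: D_def add_divide_distrib)
    qed
    also have "\<dots> \<le> c * (1 / real n ^ q)"
    proof -
      have "D / ?l \<le> norm (D / ?l)" unfolding real_norm_def by (rule abs_ge_self)
      also have "\<dots> \<le> c / 2 * (1 / real n ^ q)" using elim(1) by simp
      finally show ?thesis by linarith
    qed
    finally show ?case by simp
  qed
qed

text \<open>The expansion of the operators themselves: \<open>f\<close> is its Taylor polynomial of degree \<open>2 q\<close>, on which the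
  expansion is known, plus a remainder that is killed by localization.\<close>
lemma szasz_durrmeyer_pointwise_expansion:
  assumes x: "x > 0" and f: "f \<in> exp_space_union"
    and ad: "admits_deriv (2 * q) f x" and cont: "q = 0 \<Longrightarrow> isCont f x"
  shows "(\<lambda>n. szasz_durrmeyer n j f x -
     (\<Sum>k\<le>q. voronovskaja_coeff 0 j k (\<lambda>s. (deriv ^^ s) f x) x / real n ^ k)) \<in> o[sequentially](\<lambda>n. 1 / real n ^ q)"
proof -
  obtain A0 where A0: "f \<in> exp_space A0" using f by (auto simp: exp_space_union_def)
  \<comment> \<open>Polynomials lie in the spaces of exponent at least \<open>1\<close>.\<close>
  define A where "A = max 1 A0"
  have A: "A \<ge> 1" "A \<ge> 0" and fA: "f \<in> exp_space A"
    using exp_space_mono[OF A0, of A] by (auto simp: A_def)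
  obtain p where p: "\<And>s. s \<le> 2 * q \<Longrightarrow> poly_jet p x s = (deriv ^^ s) f x"
    using poly_with_prescribed_derivs[of "2 * q" x "\<lambda>s. (deriv ^^ s) f x"] unfolding poly_jet_def by blast
  define R where "R = (\<lambda>t. f t + (-1) * poly p t)"
  have mR: "R \<in> exp_space A" unfolding R_def by (intro exp_space_add exp_space_cmult fA poly_exp_space A)
  have "(\<lambda>n. szasz_durrmeyer n j R x) \<in> o[sequentially](\<lambda>n. 1 / real n ^ q)"
  proof (rule szasz_durrmeyer_localization[OF x mR A(1)])
    fix e :: real assume "e > 0"
    from taylor_peano_poly[OF ad _ _ this, of p] cont p
    show "\<forall>\<^sub>F t in nhds x. \<bar>R t\<bar> \<le> e * (t - x) ^ (2 * q)"
      by (simp add: R_def poly_jet_def power_even_abs)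
  qed
  then have "(\<lambda>n. szasz_durrmeyer n j R x + (szasz_durrmeyer n j (poly p) x -
     (\<Sum>k\<le>q. voronovskaja_coeff 0 j k (poly_jet p x) x / real n ^ k))) \<in> o[sequentially](\<lambda>n. 1 / real n ^ q)"
    by (intro sum_in_smallo szasz_durrmeyer_poly_expansion x)
  moreover have "voronovskaja_coeff 0 j k (poly_jet p x) x = voronovskaja_coeff 0 j k (\<lambda>s. (deriv ^^ s) f x) x" if "k \<le> q" for k
    unfolding voronovskaja_coeff_def using that by (intro sum.cong refl) (simp add: p)
  then have "(\<Sum>k\<le>q. voronovskaja_coeff 0 j k (poly_jet p x) x / real n ^ k) = 
      (\<Sum>k\<le>q. voronovskaja_coeff 0 j k (\<lambda>s. (deriv ^^ s) f x) x / real n ^ k)" for n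
    by (intro sum.cong refl) simp
  ultimately have "(\<lambda>n. szasz_durrmeyer n j R x + (szasz_durrmeyer n j (poly p) x -
     (\<Sum>k\<le>q. voronovskaja_coeff 0 j k (\<lambda>s. (deriv ^^ s) f x) x / real n ^ k))) \<in> o[sequentially](\<lambda>n. 1 / real n ^ q)"
    by simp
  then show ?thesis
  proof (rule smallo_ev_cong)
    show "\<forall>\<^sub>F n in sequentially. szasz_durrmeyer n j f x -
     (\<Sum>k\<le>q. voronovskaja_coeff 0 j k (\<lambda>s. (deriv ^^ s) f x) x / real n ^ k) = szasz_durrmeyer n j R x + (szasz_durrmeyer n j (poly p) x -
     (\<Sum>k\<le>q. voronovskaja_coeff 0 j k (\<lambda>s. (deriv ^^ s) f x) x / real n ^ k))"
      using eventually_gt_at_top[of "nat \<lceil>A\<rceil>"]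
    proof eventually_elim
      case (elim n)
      then have n: "real n > A" by linarith
      note pm = poly_exp_space[OF A(1), of p]
      have "szasz_durrmeyer n j R x = szasz_durrmeyer n j f x + (-1) * szasz_durrmeyer n j (poly p) x"
        unfolding R_def szasz_durrmeyer_add[OF fA exp_space_cmult[OF pm] n A(2)] szasz_durrmeyer_cmult[OF pm n A(2)] ..
      then show ?case by simp
    qed
  qed
qed

section \<open>Expansion of the derivatives\<close>

text \<open>The right-hand side of the difference equation is again a combination of members of the family, so it
  can be differentiated as often as desired.\<close>
lemma higher_deriv_difference_equation:
  fixes F :: "int \<Rightarrow> real \<Rightarrow> real"
  assumes "\<And>j y. (F j has_real_derivative c * (F (j - 1) y - F j y)) (at y)"
  shows "admits_deriv m (F j) y"
    and "(deriv ^^ Suc m) (F j) y = c * ((deriv ^^ m) (F (j - 1)) y - (deriv ^^ m) (F j) y)"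
proof -
  have *: "(\<forall>j y. admits_deriv m (F j) y \<and> 
     ((deriv ^^ m) (F j) has_real_derivative c * ((deriv ^^ m) (F (j - 1)) y - (deriv ^^ m) (F j) y)) (at y))" for m
  proof (induction m)
    case (Suc m)
    then have D: "((deriv ^^ m) (F j) has_real_derivative c * ((deriv ^^ m) (F (j - 1)) y - (deriv ^^ m) (F j) y)) (at y)" for j y
      by blast
    have e: "(deriv ^^ Suc m) (F j) = (\<lambda>y. c * ((deriv ^^ m) (F (j - 1)) y - (deriv ^^ m) (F j) y))" for j
      using DERIV_imp_deriv[OF D] by auto
    have "((deriv ^^ Suc m) (F j) has_real_derivative c * ((deriv ^^ Suc m) (F (j - 1)) y - (deriv ^^ Suc m) (F j) y)) (at y)" for j y
      using DERIV_cmult[OF DERIV_diff[OF D[of "j - 1" y] D[of j y]], of c] by (simp only: e)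
    moreover have "admits_deriv (Suc m) (F j) y" for j y
      using Suc D[of j y] by (auto simp: field_differentiable_def)
    ultimately show ?case by blast
  qed (use assms in simp)
  show "admits_deriv m (F j) y" using * by blast
  show "(deriv ^^ Suc m) (F j) y = c * ((deriv ^^ m) (F (j - 1)) y - (deriv ^^ m) (F j) y)"
  proof -
    have "((deriv ^^ m) (F j) has_real_derivative c * ((deriv ^^ m) (F (j - 1)) y - (deriv ^^ m) (F j) y)) (at y)"
      using *[of m] by blast
    from DERIV_imp_deriv[OF this] show ?thesis by simp
  qed
qed

lemma eventually_DERIV_szasz_durrmeyer:
  assumes "f \<in> exp_space_union"
  shows "\<forall>\<^sub>F n in sequentially. \<forall>j y. (szasz_durrmeyer n j f has_real_derivative
    real n * (szasz_durrmeyer n (j - 1) f y - szasz_durrmeyer n j f y)) (at y)"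
proof -
  obtain A where A: "A \<ge> 0" "f \<in> exp_space A" using assms by (auto simp: exp_space_union_def)
  have "\<forall>\<^sub>F n in sequentially. real n > A"
    using eventually_gt_at_top[of "nat \<lceil>A\<rceil>"] by eventually_elim linarith
  then show ?thesis
    by eventually_elim (use DERIV_szasz_durrmeyer[OF A(2) _ A(1)] in blast)
qed

text \<open>Induction on \<open>m\<close> for all \<open>j\<close> and \<open>q\<close> at once. The factor \<open>n\<close> in the difference equation costs one order
  of the expansion, so the step uses the hypothesis for \<open>q + 1\<close>; since
  \<open>2 (q + 1) + 2 m = 2 q + 2 (m + 1)\<close>, the required smoothness is exactly the available one. The leading
  coefficients for \<open>j - 1\<close> and \<open>j\<close> are both the derivative of order \<open>m\<close> and cancel.\<close>
lemma szasz_durrmeyer_deriv_expansion: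
  assumes x: "x > 0" and f: "f \<in> exp_space_union"
    and "admits_deriv (2 * q + 2 * m) f x" "q = 0 \<and> m = 0 \<Longrightarrow> isCont f x"
  shows "(\<lambda>n. (deriv ^^ m) (szasz_durrmeyer n j f) x -
     (\<Sum>k\<le>q. voronovskaja_coeff m j k (\<lambda>s. (deriv ^^ s) f x) x / real n ^ k)) \<in> o[sequentially](\<lambda>n. 1 / real n ^ q)"
  using assms(3,4)
proof (induction m arbitrary: q j)
  case 0
  then show ?case using szasz_durrmeyer_pointwise_expansion[OF x f, of q j] by simp
next
  case (Suc m)
  let ?d = "\<lambda>s. (deriv ^^ s) f x"
  \<comment> \<open>The errors for \<open>j - 1\<close> and \<open>j\<close> at order \<open>q + 1\<close>; \<open>n\<close> times their difference is the error for \<open>m + 1\<close>.\<close>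
  define E where "E = (\<lambda>j n. (deriv ^^ m) (szasz_durrmeyer n j f) x -
     (\<Sum>k\<le>Suc q. voronovskaja_coeff m j k ?d x / real n ^ k))"
  have "E j \<in> o[sequentially](\<lambda>n. 1 / real n ^ Suc q)" for j
    unfolding E_def using Suc.prems by (intro Suc.IH) auto
  then have "(\<lambda>n. E (j - 1) n - E j n) \<in> o[sequentially](\<lambda>n. 1 / real n ^ Suc q)"
    by (intro sum_in_smallo)
  then have "(\<lambda>n. real n * (E (j - 1) n - E j n)) \<in> o[sequentially](\<lambda>n. real n * (1 / real n ^ Suc q))"
    by (intro landau_o.small.mult_left) simp_all
  also have "(\<lambda>n. real n * (1 / real n ^ Suc q)) \<in> O[sequentially](\<lambda>n. 1 / real n ^ q)"
    by (intro bigoI[of _ 1]) (auto intro!: always_eventually)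
  finally have "(\<lambda>n. real n * (E (j - 1) n - E j n)) \<in> o[sequentially](\<lambda>n. 1 / real n ^ q)" .
  then show ?case
  proof (rule smallo_ev_cong)
    show "\<forall>\<^sub>F n in sequentially. (deriv ^^ Suc m) (szasz_durrmeyer n j f) x -
       (\<Sum>k\<le>q. voronovskaja_coeff (Suc m) j k ?d x / real n ^ k) = real n * (E (j - 1) n - E j n)"
      using eventually_DERIV_szasz_durrmeyer[OF f] eventually_gt_at_top[of 0]
    proof eventually_elim
      case (elim n)
      have "(deriv ^^ Suc m) (szasz_durrmeyer n j f) x =
        real n * ((deriv ^^ m) (szasz_durrmeyer n (j - 1) f) x - (deriv ^^ m) (szasz_durrmeyer n j f) x)"
        using elim(1) by (intro higher_deriv_difference_equation) blast
      moreover have "(\<Sum>k\<le>q. voronovskaja_coeff (Suc m) j k ?d x / real n ^ k) =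
         real n * ((\<Sum>k\<le>Suc q. voronovskaja_coeff m (j - 1) k ?d x / real n ^ k) - (\<Sum>k\<le>Suc q. voronovskaja_coeff m j k ?d x / real n ^ k))"
        unfolding sum.atMost_Suc_shift[of _ q] voronovskaja_coeff_0 voronovskaja_coeff_deriv_order
        using elim(2) by (simp add: sum_subtractf diff_divide_distrib right_diff_distrib sum_distrib_left)
      ultimately show ?case by (simp add: E_def algebra_simps)
    qed
  qed
qed

theorem theorem26:
  fixes j :: int and x :: real and q m :: nat and f :: "real \<Rightarrow> real"
  assumes "x > 0"
    and "f \<in> exp_space_union"
    and "admits_deriv (2 * q + 2 * m) f x"
    and "q = 0 \<and> m = 0 \<Longrightarrow> isCont f x"
  shows "(\<forall>\<^sub>F n in sequentially. admits_deriv m (szasz_durrmeyer n j f) x) \<and>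
    (\<forall>k\<le>q. admits_deriv (k + m) (\<lambda>t. t powi (int k - j) * (deriv ^^ k) f t) x \<and>
            admits_deriv m (expansion_coeff k j f) x \<and>
            expansion_coeff k j f x =
              1 / fact k * (x powi j * (deriv ^^ k) (\<lambda>t. t powi (int k - j) * (deriv ^^ k) f t) x)) \<and>
    (\<lambda>n. (deriv ^^ m) (szasz_durrmeyer n j f) x -
         (\<Sum>k=0..q. (deriv ^^ m) (expansion_coeff k j f) x * (1 / real n ^ k)))
      \<in> o[sequentially](\<lambda>n. 1 / real n ^ q) \<and>
    (\<lambda>n. (deriv ^^ m) (szasz_durrmeyer n j f) x -
         (\<Sum>k=0..q. 1 / real n ^ k *
            (\<Sum>i=0..k. 1 / fact i * (real_of_int (int k + int m - j) gchoose (k - i)) * x ^ i *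
                        (deriv ^^ (k + m + i)) f x)))
      \<in> o[sequentially](\<lambda>n. 1 / real n ^ q)"
proof (intro conjI allI impI)
  let ?v = "\<lambda>k. voronovskaja_coeff m j k (\<lambda>s. (deriv ^^ s) f x) x"
  show "\<forall>\<^sub>F n in sequentially. admits_deriv m (szasz_durrmeyer n j f) x"
    using eventually_DERIV_szasz_durrmeyer[OF assms(2)]
    by eventually_elim (intro higher_deriv_difference_equation, blast)
  note exp = szasz_durrmeyer_deriv_expansion[OF assms, of j]
  have coeff: "admits_deriv m (expansion_coeff k j f) x" "(deriv ^^ m) (expansion_coeff k j f) x = ?v k"
    if "k \<le> q" for k
    using expansion_coeff_higher_deriv[OF assms(1) admits_deriv_mono[OF assms(3)], of k m j] that by auto
  show "(\<lambda>n. (deriv ^^ m) (szasz_durrmeyer n j f) x -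
         (\<Sum>k=0..q. (deriv ^^ m) (expansion_coeff k j f) x * (1 / real n ^ k)))
      \<in> o[sequentially](\<lambda>n. 1 / real n ^ q)"
    using exp by (simp add: coeff atLeast0AtMost)
  show "(\<lambda>n. (deriv ^^ m) (szasz_durrmeyer n j f) x -
         (\<Sum>k=0..q. 1 / real n ^ k *
            (\<Sum>i=0..k. 1 / fact i * (real_of_int (int k + int m - j) gchoose (k - i)) * x ^ i *
                        (deriv ^^ (k + m + i)) f x)))
      \<in> o[sequentially](\<lambda>n. 1 / real n ^ q)"
    using exp unfolding voronovskaja_coeff_def by (simp add: atLeast0AtMost)
  fix k assume k: "k \<le> q"
  show "admits_deriv m (expansion_coeff k j f) x" by (rule coeff[OF k])
  show "expansion_coeff k j f x =
     1 / fact k * (x powi j * (deriv ^^ k) (\<lambda>t. t powi (int k - j) * (deriv ^^ k) f t) x)"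
    by (rule expansion_coeff_alt[OF assms(1)])
  have "admits_deriv (k + m) ((deriv ^^ k) f) x"
    by (rule admits_deriv_funpow, rule admits_deriv_mono[OF assms(3)]) (use k in simp)
  then show "admits_deriv (k + m) (\<lambda>t. t powi (int k - j) * (deriv ^^ k) f t) x"
    using powi_mult_higher_deriv[OF assms(1)] by blast
qed

end
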